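(* Let $H$ be an $m\times n$ matrix with i.i.d. standard normal components. Let $n$ be large and let $m=\alpha n$, where $\alpha>0$ is a constant independent of $n$. Let $$\xi_n=\min_{x\in\{-\frac{1}{\sqrt n},\frac{1}{\sqrt n}\}^n}\ \max_{y\in\{-\frac{1}{\sqrt m},\frac{1}{\sqrt m}\}^m} y^T H x .$$ Let $\epsilon_1^{(m)},\epsilon_1^{(n)},\epsilon_5^{(g)}$ be arbitrarily small positive constants independent of $n$ and let $\xi_n^{(l)}$ be a scalar such that $$(1-\epsilon_1^{(m)})\sqrt{\alpha}\sqrt{\frac{2}{\pi}}-(1+\epsilon_1^{(n)})\sqrt{\frac{2}{\pi}}-\epsilon_5^{(g)}>\frac{\xi_n^{(l)}}{\sqrt n}.$$ Then $$\lim_{n\to\infty}P\Big(\min_{x\in\{-\frac{1}{\sqrt n},\frac{1}{\sqrt n}\}^n}\ \max_{y\in\{-\frac{1}{\sqrt m},\frac{1}{\sqrt m}\}^m} y^T H x\ge \xi_n^{(l)}\Big)\ge 1$$ $$\Leftrightarrow\ \lim_{n\to\infty}P\big(\xi_n\ge \xi_n^{(l)}\big)\ge 1$$ $$\Leftrightarrow\ \lim_{n\to\infty}P\big(\xi_n^2\ge (\xi_n^{(l)})^2\big)\ge 1,$$ and $$\frac{E\xi_n}{\sqrt n}=\frac{E\Big(\min_{x\in\{-\frac{1}{\sqrt n},\frac{1}{\sqrt n}\}^n}\ \max_{y\in\{-\frac{1}{\sqrt m},\frac{1}{\sqrt m}\}^m} y^T H x\Big)}{\sqrt n}\ \ge\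 (\sqrt{\alpha}-1)\sqrt{\frac{2}{\pi}}.$$
   Context: $P$ and $E$ denote probability and expectation with respect to the random matrix $H$. The subscript in $\xi_n$ is part of its name (it marks the minmax value); $\xi_n$ depends on $H$, $n$ and $m=\alpha n$. The chain of equivalences is asserted as a conclusion: all three probability statements are claimed to hold.
   Formalization: The third limit, P(ξ_n² ≥ (ξ_n^(l))²) → 1, is proved only when ξ_n^(l) ≥ 0 for all large n; as printed it fails, e.g. for ξ_n^(l) = −C√n with C large. When αn is not an integer, m is αn rounded up. *)

theory Defs
  imports "HOL-Probability.Probability"
begin

text \<open>
  A vector of length \<open>n\<close> is a function \<open>nat \<Rightarrow> real\<close> with index set \<open>{..<n}\<close>, and an \<open>m \<times> n\<close>
  matrix a function \<open>nat \<Rightarrow> nat \<Rightarrow> real\<close> with index set \<open>{..<m} \<times> {..<n}\<close>. This lets the dimension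
  vary with \<open>n\<close>. Values of matrices outside the index set are never used.
\<close>

definition bilin :: "nat \<Rightarrow> nat \<Rightarrow> (nat \<Rightarrow> nat \<Rightarrow> real) \<Rightarrow> (nat \<Rightarrow> real) \<Rightarrow> (nat \<Rightarrow> real) \<Rightarrow> real" where
  "bilin m n A y x = (\<Sum>i<m. \<Sum>j<n. y i * A i j * x j)"

text \<open>Extensionality of the function space \<open>\<rightarrow>\<^sub>E\<close> makes the cube a finite set.\<close>

definition normalized_cube :: "nat \<Rightarrow> (nat \<Rightarrow> real) set" where
  "normalized_cube n = {..<n} \<rightarrow>\<^sub>E {- 1 / sqrt (real n), 1 / sqrt (real n)}"

definition minmax_value :: "nat \<Rightarrow> nat \<Rightarrow> (nat \<Rightarrow> nat \<Rightarrow> real) \<Rightarrow> real" where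
  "minmax_value m n A =
     (MIN x\<in>normalized_cube n. MAX y\<in>normalized_cube m. bilin m n A y x)"

definition std_normal_matrix ::
  "'a measure \<Rightarrow> nat \<Rightarrow> nat \<Rightarrow> ('a \<Rightarrow> nat \<Rightarrow> nat \<Rightarrow> real) \<Rightarrow> bool" where
  "std_normal_matrix M m n H \<longleftrightarrow>
     prob_space.indep_vars M (\<lambda>_. borel) (\<lambda>(i, j) \<omega>. H \<omega> i j) ({..<m} \<times> {..<n}) \<and>
     (\<forall>i<m. \<forall>j<n. distributed M lborel (\<lambda>\<omega>. H \<omega> i j) std_normal_density)"

text \<open>
  The number of rows \<open>m = \<alpha> n\<close>. It is exactly \<open>\<alpha> n\<close> whenever that is an integer, and is rounded up
  otherwise, so that every real \<open>\<alpha> > 0\<close> and every \<open>n\<close> are covered.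
\<close>

definition num_rows :: "real \<Rightarrow> nat \<Rightarrow> nat" where
  "num_rows \<alpha> n = nat \<lceil>\<alpha> * real n\<rceil>"

text \<open>\<open>lim\<close> is an unspecified value on divergent sequences, so existence of the limit is included.\<close>

definition lim_ge :: "(nat \<Rightarrow> real) \<Rightarrow> real \<Rightarrow> bool" where
  "lim_ge X c \<longleftrightarrow> convergent X \<and> lim X \<ge> c"

end

theory Submission
  imports Defs "HOL-Real_Asymp.Real_Asymp"
begin

text \<open>
  Let \<open>g\<close>, \<open>h\<close> and \<open>\<gamma>\<close> be Gaussian vectors and a Gaussian scalar, independent of each other and
  of \<open>H\<close>. The processes \<open>X(x,y) = y\<^sup>T H x + \<gamma>\<close> and \<open>Y(x,y) = g\<^sup>T y + h\<^sup>T x\<close> satisfy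
  \<open>E X(x,y) X(x',y') - E Y(x,y) Y(x',y') = (1 - \<langle>x,x'\<rangle>) (1 - \<langle>y,y'\<rangle>) \<ge> 0\<close>, with equality for
  \<open>x = x'\<close>. By Gordon's comparison, \<open>P(min max X \<ge> c) \<ge> P(min max Y \<ge> c)\<close> for every \<open>c\<close>, and
  \<open>min max Y\<close> is the explicit variable \<open>\<parallel>g\<parallel>\<^sub>1 / sqrt m - \<parallel>h\<parallel>\<^sub>1 / sqrt n\<close>, of mean
  \<open>sqrt (2 / \<pi>) (sqrt m - sqrt n)\<close> and variance at most 2. Integrating the tails gives the bound on
  \<open>E \<xi>\<^sub>n\<close>, and Chebyshev's inequality for \<open>min max Y\<close> and \<open>\<gamma>\<close> gives the limits.

  Gordon's comparison follows by Lindeberg's replacement method: \<open>X\<close> is distributed as a normalised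
  sum of \<open>N\<close> independent copies, and replacing one copy of \<open>X\<close> by one of \<open>Y\<close> changes the
  expectation of a smooth test function by a second-order term of known sign and an error of order
  \<open>N powr (-3/2)\<close>.
\<close>

section \<open>Smooth functions of finitely many coordinates\<close>

text \<open>
  The type \<open>'k \<Rightarrow> real\<close> carries no norm here, so differentiability is imposed along all lines.
\<close>

definition has_partials ::
  "'k set \<Rightarrow> (('k \<Rightarrow> real) \<Rightarrow> real) \<Rightarrow> ('k \<Rightarrow> ('k \<Rightarrow> real) \<Rightarrow> real) \<Rightarrow> bool" where
  "has_partials K F D \<longleftrightarrow>
     (\<forall>z v t. ((\<lambda>t. F (\<lambda>k. z k + t * v k)) has_real_derivative
        (\<Sum>k\<in>K. v k * D k (\<lambda>k. z k + t * v k))) (at t))"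

text \<open>Bounded partial derivatives in the directions of \<open>K\<close> up to order
  \<open>j\<close>. The recursive form allows closure under sums and products to be proved by
  induction on the order, so that smoothness of products of logistic steps reduces to that of one
  step.\<close>

fun bounded_smooth :: "nat \<Rightarrow> 'k set \<Rightarrow> (('k \<Rightarrow> real) \<Rightarrow> real) \<Rightarrow> bool" where
  "bounded_smooth 0 K F \<longleftrightarrow> (\<exists>C. \<forall>z. \<bar>F z\<bar> \<le> C)"
| "bounded_smooth (Suc j) K F \<longleftrightarrow> (\<exists>C. \<forall>z. \<bar>F z\<bar> \<le> C) \<and>
     (\<exists>D. has_partials K F D \<and> (\<forall>k\<in>K. bounded_smooth j K (D k)))"

lemma has_partialsD:
  "has_partials K F D \<Longrightarrow> ((\<lambda>t. F (\<lambda>k. z k + t * v k)) has_real_derivative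
        (\<Sum>k\<in>K. v k * D k (\<lambda>k. z k + t * v k))) (at t)"
  unfolding has_partials_def by blast

lemma bounded_smooth_bounded: "bounded_smooth j K F \<Longrightarrow> \<exists>C. \<forall>z. \<bar>F z\<bar> \<le> C"
  by (cases j) auto

lemma bounded_smooth_SucD: "bounded_smooth (Suc j) K F \<Longrightarrow> bounded_smooth j K F"
  by (induction j arbitrary: F) (simp, metis bounded_smooth.simps(2))

lemma bounded_smooth_const: "bounded_smooth j K (\<lambda>_. c)"
proof (induction j arbitrary: c)
  case (Suc j)
  have "has_partials K (\<lambda>_. c) (\<lambda>_ _. 0)"
    by (auto simp: has_partials_def)
  with Suc show ?case by auto
qed auto

lemma has_partials_add:
  assumes "has_partials K F D" "has_partials K G E"
  shows "has_partials K (\<lambda>z. F z + G z) (\<lambda>k z. D k z + E k z)"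
  unfolding has_partials_def
proof (intro allI)
  fix z v :: "'a \<Rightarrow> real" and t :: real
  show "((\<lambda>t. F (\<lambda>k. z k + t * v k) + G (\<lambda>k. z k + t * v k)) has_real_derivative
        (\<Sum>k\<in>K. v k * (D k (\<lambda>k. z k + t * v k) + E k (\<lambda>k. z k + t * v k)))) (at t)"
    by (rule DERIV_cong[OF DERIV_add[OF assms[THEN has_partialsD]]])
       (simp add: sum.distrib distrib_left)
qed

lemma has_partials_mult:
  assumes "has_partials K F D" "has_partials K G E"
  shows "has_partials K (\<lambda>z. F z * G z) (\<lambda>k z. D k z * G z + F z * E k z)"
  unfolding has_partials_def
proof (intro allI)
  fix z v :: "'a \<Rightarrow> real" and t :: real
  show "((\<lambda>t. F (\<lambda>k. z k + t * v k) * G (\<lambda>k. z k + t * v k)) has_real_derivative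
        (\<Sum>k\<in>K. v k * (D k (\<lambda>k. z k + t * v k) * G (\<lambda>k. z k + t * v k) +
            F (\<lambda>k. z k + t * v k) * E k (\<lambda>k. z k + t * v k)))) (at t)"
    by (rule DERIV_cong[OF DERIV_mult[OF assms[THEN has_partialsD]]])
       (simp add: sum.distrib distrib_left sum_distrib_left sum_distrib_right algebra_simps)
qed

lemma bounded_smooth_add:
  "bounded_smooth j K F \<Longrightarrow> bounded_smooth j K G \<Longrightarrow> bounded_smooth j K (\<lambda>z. F z + G z)"
proof (induction j arbitrary: F G)
  case 0
  then obtain C C' where "\<forall>z. \<bar>F z\<bar> \<le> C" "\<forall>z. \<bar>G z\<bar> \<le> C'" by auto
  then have "\<bar>F z + G z\<bar> \<le> C + C'" for z
    by (meson abs_triangle_ineq add_mono order_trans)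
  then show ?case by auto
next
  case (Suc j)
  then obtain C C' where "\<forall>z. \<bar>F z\<bar> \<le> C" "\<forall>z. \<bar>G z\<bar> \<le> C'" by auto
  then have "\<bar>F z + G z\<bar> \<le> C + C'" for z
    by (meson abs_triangle_ineq add_mono order_trans)
  moreover obtain D E where "has_partials K F D" "has_partials K G E"
    and "\<forall>k\<in>K. bounded_smooth j K (D k)" "\<forall>k\<in>K. bounded_smooth j K (E k)"
    using Suc.prems by auto
  ultimately show ?case
    using Suc.IH has_partials_add[of K F D G E] by auto
qed

text \<open>The product rule writes each partial of \<open>F * G\<close> through products of
  functions of order \<open>j\<close>; \<open>F\<close> and \<open>G\<close> themselves are lowered
  by one order to meet the induction hypothesis.\<close>

lemma bounded_smooth_mult:
  "bounded_smooth j K F \<Longrightarrow> bounded_smooth j K G \<Longrightarrow> bounded_smooth j K (\<lambda>z. F z * G z)"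
proof (induction j arbitrary: F G)
  case 0
  then obtain C C' where "\<forall>z. \<bar>F z\<bar> \<le> C" "\<forall>z. \<bar>G z\<bar> \<le> C'" by auto
  then have "\<bar>F z * G z\<bar> \<le> C * C'" for z
    by (simp only: abs_mult) (intro mult_mono, auto intro: order_trans[OF abs_ge_zero])
  then show ?case by auto
next
  case (Suc j)
  then obtain C C' where "\<forall>z. \<bar>F z\<bar> \<le> C" "\<forall>z. \<bar>G z\<bar> \<le> C'" by auto
  then have "\<bar>F z * G z\<bar> \<le> C * C'" for z
    by (simp only: abs_mult) (intro mult_mono, auto intro: order_trans[OF abs_ge_zero])
  moreover obtain D E where DE: "has_partials K F D" "has_partials K G E"
    and "\<forall>k\<in>K. bounded_smooth j K (D k)" "\<forall>k\<in>K. bounded_smooth j K (E k)"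
    using Suc.prems by auto
  then have "\<forall>k\<in>K. bounded_smooth j K (\<lambda>z. D k z * G z + F z * E k z)"
    using Suc.prems[THEN bounded_smooth_SucD] by (auto intro!: bounded_smooth_add Suc.IH)
  ultimately show ?case
    using has_partials_mult[OF DE] by auto
qed

lemma bounded_smooth_prod:
  "(\<And>i. i \<in> S \<Longrightarrow> bounded_smooth j K (F i)) \<Longrightarrow> bounded_smooth j K (\<lambda>z. \<Prod>i\<in>S. F i z)"
  by (induction S rule: infinite_finite_induct)
     (auto intro: bounded_smooth_const bounded_smooth_mult)

lemma bounded_smooth_one_minus:
  "bounded_smooth j K F \<Longrightarrow> bounded_smooth j K (\<lambda>z. 1 - F z)"
  using bounded_smooth_add[OF bounded_smooth_const[of j K 1]
      bounded_smooth_mult[OF bounded_smooth_const[of j K "-1"]], of F] by simp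

section \<open>The logistic function as a smooth step\<close>

definition logistic :: "real \<Rightarrow> real" where
  "logistic x = 1 / (1 + exp (- x))"

lemma logistic_bounds: "0 < logistic x" "logistic x < 1"
  by (auto simp: logistic_def add_pos_pos)

lemma abs_logistic_le_one: "\<bar>logistic x\<bar> \<le> 1"
  using logistic_bounds[of x] by linarith

lemma logistic_mono: "x \<le> y \<Longrightarrow> logistic x \<le> logistic y"
  unfolding logistic_def by (intro divide_left_mono) (auto simp: add_pos_pos)

lemma DERIV_logistic:
  "(logistic has_real_derivative logistic x * (1 - logistic x)) (at x)"
proof -
  have "1 + exp (- x) \<noteq> 0" by (metis add_pos_pos exp_gt_zero less_irrefl zero_less_one)
  then show ?thesis
    unfolding logistic_def[abs_def]
    by (auto intro!: derivative_eq_intros simp: field_simps power2_eq_square)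
qed

lemma borel_measurable_logistic [measurable]: "logistic \<in> borel_measurable borel"
  unfolding logistic_def[abs_def] by measurable

text \<open>The derivative of the logistic function \<open>L\<close> is \<open>L * (1 - L)\<close>,
  a polynomial in \<open>L\<close> itself, so induction on the order closes with the rules for
  products and complements.\<close>

lemma bounded_smooth_logistic:
  assumes K: "finite K" "k \<in> K"
  shows "bounded_smooth j K (\<lambda>z. logistic (c * z k + d))"
proof (induction j)
  case 0
  show ?case unfolding bounded_smooth.simps using abs_logistic_le_one by blast
next
  case (Suc j)
  let ?L = "\<lambda>z. logistic (c * z k + d)"
  let ?D = "\<lambda>l z. if l = k then c * (?L z * (1 - ?L z)) else 0"
  have "has_partials K ?L ?D"
    unfolding has_partials_def
  proof (intro allI)
    fix z v :: "'a \<Rightarrow> real" and t :: real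
    have "((\<lambda>t. c * (z k + t * v k) + d) has_real_derivative c * v k) (at t)"
      by (auto intro!: derivative_eq_intros)
    from DERIV_chain2[OF DERIV_logistic this]
    show "((\<lambda>t. logistic (c * (z k + t * v k) + d)) has_real_derivative
        (\<Sum>l\<in>K. v l * (if l = k then c * (logistic (c * (z k + t * v k) + d) *
          (1 - logistic (c * (z k + t * v k) + d))) else 0))) (at t)"
      using K by (simp add: if_distrib[where f="\<lambda>x. _ * x"] sum.delta ac_simps cong: if_cong)
  qed
  moreover have "\<exists>C. \<forall>z. \<bar>?L z\<bar> \<le> C"
    using abs_logistic_le_one by blast
  moreover have "bounded_smooth j K (?D l)" for l
    using bounded_smooth_mult[OF bounded_smooth_const[of j K c]
       bounded_smooth_mult[OF Suc.IH bounded_smooth_one_minus[OF Suc.IH]]]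
    by (cases "l = k") (simp_all add: bounded_smooth_const)
  ultimately show ?case by auto
qed

text \<open>Taylor's formula for \<open>F\<close> along the segment from \<open>s\<close> to
  \<open>s + v\<close>. The constant \<open>C\<close> is uniform in \<open>s\<close> and
  \<open>v\<close> because it bounds all third partials globally; this uniformity is what the
  iterated replacement relies on.\<close>

lemma bounded_smooth_taylor:
  assumes K: "finite K" and F: "bounded_smooth 3 K F"
  obtains D1 D2 C where "has_partials K F D1" "\<And>k. k \<in> K \<Longrightarrow> has_partials K (D1 k) (D2 k)" "C \<ge> 0"
    "\<And>s v. \<bar>F (\<lambda>k. s k + v k) - F s - (\<Sum>k\<in>K. v k * D1 k s)
       - (\<Sum>k\<in>K. \<Sum>l\<in>K. v k * v l * D2 k l s) / 2\<bar> \<le> C * (\<Sum>k\<in>K. \<bar>v k\<bar>) ^ 3"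
proof -
  have "bounded_smooth (Suc 2) K F" using F by (simp add: numeral_eq_Suc)
  then obtain D1 where D1: "has_partials K F D1" and "\<And>k. k \<in> K \<Longrightarrow> bounded_smooth 2 K (D1 k)"
    by (subst (asm) bounded_smooth.simps(2)) blast
  then have "\<forall>k\<in>K. \<exists>D. has_partials K (D1 k) D \<and> (\<forall>l\<in>K. bounded_smooth 1 K (D l))"
    by (metis One_nat_def Suc_1 bounded_smooth.simps(2))
  then obtain D2 where D2: "\<And>k. k \<in> K \<Longrightarrow> has_partials K (D1 k) (D2 k)"
    and "\<And>k l. k \<in> K \<Longrightarrow> l \<in> K \<Longrightarrow> bounded_smooth 1 K (D2 k l)"
    by metis
  then have "\<forall>k\<in>K. \<forall>l\<in>K. \<exists>D. has_partials K (D2 k l) D \<and> (\<forall>h\<in>K. bounded_smooth 0 K (D h))"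
    by (metis One_nat_def bounded_smooth.simps(2))
  then obtain D3 where D3: "\<And>k l. k \<in> K \<Longrightarrow> l \<in> K \<Longrightarrow> has_partials K (D2 k l) (D3 k l)"
    and "\<And>k l h. k \<in> K \<Longrightarrow> l \<in> K \<Longrightarrow> h \<in> K \<Longrightarrow> bounded_smooth 0 K (D3 k l h)"
    by metis
  then have "\<forall>k\<in>K. \<forall>l\<in>K. \<forall>h\<in>K. \<exists>C. \<forall>z. \<bar>D3 k l h z\<bar> \<le> C" by auto
  then obtain c where c: "\<And>k l h z. k \<in> K \<Longrightarrow> l \<in> K \<Longrightarrow> h \<in> K \<Longrightarrow> \<bar>D3 k l h z\<bar> \<le> c k l h"
    by metis
  \<comment> \<open>Summing the finitely many separate bounds yields one constant for all third
    partials.\<close>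
  define C where "C = (\<Sum>k\<in>K. \<Sum>l\<in>K. \<Sum>h\<in>K. \<bar>c k l h\<bar>)"
  have C: "\<bar>D3 k l h z\<bar> \<le> C" if "k \<in> K" "l \<in> K" "h \<in> K" for k l h z
  proof -
    have "\<bar>D3 k l h z\<bar> \<le> \<bar>c k l h\<bar>" using c[OF that] by (meson abs_ge_self order_trans)
    also have "\<dots> \<le> (\<Sum>h\<in>K. \<bar>c k l h\<bar>)" using that K by (intro member_le_sum) auto
    also have "\<dots> \<le> (\<Sum>l\<in>K. \<Sum>h\<in>K. \<bar>c k l h\<bar>)"
      using that K by (intro member_le_sum[where f="\<lambda>l. \<Sum>h\<in>K. \<bar>c k l h\<bar>"]) (auto intro: sum_nonneg)
    also have "\<dots> \<le> C"
      unfolding C_def using that K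
      by (intro member_le_sum[where f="\<lambda>k. \<Sum>l\<in>K. \<Sum>h\<in>K. \<bar>c k l h\<bar>"]) (auto intro: sum_nonneg)
    finally show ?thesis .
  qed
  have C0: "C \<ge> 0" unfolding C_def by (auto intro!: sum_nonneg)
  show thesis
  proof (rule that[OF D1 D2 C0])
    fix s v :: "'a \<Rightarrow> real"
    let ?z = "\<lambda>t k. s k + t * v k"
    let ?u1 = "\<lambda>t. \<Sum>k\<in>K. v k * D1 k (?z t)"
    let ?u2 = "\<lambda>t. \<Sum>k\<in>K. \<Sum>l\<in>K. v k * v l * D2 k l (?z t)"
    let ?u3 = "\<lambda>t. \<Sum>k\<in>K. \<Sum>l\<in>K. \<Sum>h\<in>K. v k * v l * v h * D3 k l h (?z t)"
    \<comment> \<open>The derivatives of orders 0 to 3 along the segment, in the shape required by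
      Maclaurin's formula; from order 3 on the value is constantly \<open>?u3\<close>, and only
      order 3 enters the remainder.\<close>
    define diff where "diff m = (if m = 0 then (\<lambda>t. F (?z t)) else if m = 1 then ?u1
      else if m = 2 then ?u2 else ?u3)" for m :: nat
    have "((\<lambda>t. F (?z t)) has_real_derivative ?u1 t) (at t)" for t
      by (rule has_partialsD[OF D1])
    moreover have "(?u1 has_real_derivative ?u2 t) (at t)" for t
    proof (rule DERIV_cong[OF DERIV_sum])
      show "((\<lambda>t. v k * D1 k (?z t)) has_real_derivative (v k * (\<Sum>l\<in>K. v l * D2 k l (?z t)))) (at t)"
        if "k \<in> K" for k
        by (intro DERIV_cmult has_partialsD D2 that)
    qed (simp add: sum_distrib_left mult.assoc)
    moreover have "(?u2 has_real_derivative ?u3 t) (at t)" for t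
    proof (rule DERIV_cong[OF DERIV_sum], rule DERIV_sum)
      show "((\<lambda>t. v k * v l * D2 k l (?z t)) has_real_derivative
          (v k * v l * (\<Sum>h\<in>K. v h * D3 k l h (?z t)))) (at t)"
        if "k \<in> K" "l \<in> K" for k l
        by (intro DERIV_cmult has_partialsD D3 that)
    qed (simp add: sum_distrib_left mult.assoc)
    ultimately have "\<forall>m t. m < 3 \<and> 0 \<le> t \<and> t \<le> 1 \<longrightarrow> DERIV (diff m) t :> diff (Suc m) t"
      by (auto simp: diff_def less_Suc_eq numeral_eq_Suc)
    from Maclaurin[OF _ _ _ this, of "diff 0"] obtain t where
      t: "diff 0 1 = (\<Sum>m<3. diff m 0 / fact m * 1 ^ m) + diff 3 t / fact 3 * 1 ^ 3"
      by auto
    have "\<bar>?u3 t\<bar> \<le> (\<Sum>k\<in>K. \<Sum>l\<in>K. \<Sum>h\<in>K. \<bar>v k * v l * v h * D3 k l h (?z t)\<bar>)"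
      by (intro order_trans[OF sum_abs] sum_mono order_refl)
    also have "\<dots> \<le> (\<Sum>k\<in>K. \<Sum>l\<in>K. \<Sum>h\<in>K. \<bar>v k\<bar> * \<bar>v l\<bar> * \<bar>v h\<bar> * C)"
      by (intro sum_mono) (auto simp: abs_mult intro!: mult_left_mono C)
    also have "\<dots> = C * (\<Sum>k\<in>K. \<bar>v k\<bar>) ^ 3"
      by (simp add: power3_eq_cube sum_product sum_distrib_left sum_distrib_right mult_ac)
    finally have "\<bar>?u3 t\<bar> \<le> C * (\<Sum>k\<in>K. \<bar>v k\<bar>) ^ 3" .
    then have 3: "\<bar>?u3 t\<bar> / 6 \<le> C * (\<Sum>k\<in>K. \<bar>v k\<bar>) ^ 3" by linarith
    have "F (\<lambda>k. s k + v k) - F s - (\<Sum>k\<in>K. v k * D1 k s)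
       - (\<Sum>k\<in>K. \<Sum>l\<in>K. v k * v l * D2 k l s) / 2 = ?u3 t / 6"
      using t by (simp add: diff_def numeral_eq_Suc fact_numeral)
    then show "\<bar>F (\<lambda>k. s k + v k) - F s - (\<Sum>k\<in>K. v k * D1 k s)
       - (\<Sum>k\<in>K. \<Sum>l\<in>K. v k * v l * D2 k l s) / 2\<bar> \<le> C * (\<Sum>k\<in>K. \<bar>v k\<bar>) ^ 3"
      using 3 by (simp add: abs_divide)
  qed
qed

section \<open>Supermodularity and the sign of mixed partials\<close>

definition supermodular_in :: "'k \<Rightarrow> 'k \<Rightarrow> (('k \<Rightarrow> real) \<Rightarrow> real) \<Rightarrow> bool" where
  "supermodular_in k l F \<longleftrightarrow> (\<forall>z a b. 0 \<le> a \<longrightarrow> 0 \<le> b \<longrightarrow>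
     F (z(k := z k + a)) + F (z(l := z l + b)) \<le> F (z(k := z k + a, l := z l + b)) + F z)"

lemma has_partials_coord:
  assumes "has_partials K F D" "finite K" "k \<in> K"
  shows "((\<lambda>t. F (z(k := z k + t))) has_real_derivative D k (z(k := z k + t))) (at t)"
proof -
  have "(\<lambda>l. z l + t * (if l = k then 1 else 0)) = z(k := z k + t)" for t
    by (auto simp: fun_eq_iff)
  then show ?thesis
    using has_partialsD[OF assms(1), of z "\<lambda>l. if l = k then 1 else 0" t] assms(2,3)
    by (simp add: if_distrib[where f="\<lambda>x. x * _"] sum.delta cong: if_cong)
qed

text \<open>Supermodularity says that the increment of \<open>F\<close> in direction
  \<open>l\<close> grows along direction \<open>k\<close>. Differentiating in \<open>k\<close> makes
  \<open>D1 k\<close> monotone in coordinate \<open>l\<close>, and differentiating that in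
  \<open>l\<close> gives the sign.\<close>

lemma supermodular_in_second_partial_nonneg:
  assumes "finite K" "k \<in> K" "l \<in> K" "k \<noteq> l" and sm: "supermodular_in k l F"
    and D1: "has_partials K F D1" and D2: "has_partials K (D1 k) (D2 k)"
  shows "D2 k l z \<ge> 0"
proof -
  have first: "D1 k z \<le> D1 k (z(l := z l + b))" if "b \<ge> 0" for b z
  proof -
    \<comment> \<open>The gain from raising coordinate \<open>l\<close> by \<open>b\<close>, as a
      function of the shift \<open>t\<close> of coordinate \<open>k\<close>. Its derivative at 0 is
      the difference of the two values of \<open>D1 k\<close>.\<close>
    let ?f = "\<lambda>t. F ((z(l := z l + b))(k := (z(l := z l + b)) k + t)) - F (z(k := z k + t))"
    have "mono_on UNIV ?f"
    proof (intro mono_onI)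
      fix t t' :: real assume "t \<le> t'"
      let ?w = "z(k := z k + t)"
      have "F (?w(k := ?w k + (t' - t))) + F (?w(l := ?w l + b))
          \<le> F (?w(k := ?w k + (t' - t), l := ?w l + b)) + F ?w"
        using sm \<open>t \<le> t'\<close> \<open>b \<ge> 0\<close> unfolding supermodular_in_def by (metis diff_ge_0_iff_ge)
      then show "?f t \<le> ?f t'"
        using \<open>k \<noteq> l\<close> by (simp add: fun_upd_twist algebra_simps)
    qed
    moreover have "(?f has_real_derivative
        D1 k ((z(l := z l + b))(k := (z(l := z l + b)) k + 0)) - D1 k (z(k := z k + 0))) (at 0)"
      by (intro DERIV_diff has_partials_coord[OF D1] assms)
    ultimately have "D1 k ((z(l := z l + b))(k := (z(l := z l + b)) k + 0)) - D1 k (z(k := z k + 0)) \<ge> 0"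
      by (rule mono_on_imp_deriv_nonneg) auto
    then show ?thesis using \<open>k \<noteq> l\<close> by (simp add: fun_upd_twist)
  qed
  let ?g = "\<lambda>t. D1 k (z(l := z l + t))"
  have "mono_on UNIV ?g"
  proof (intro mono_onI)
    fix t t' :: real assume "t \<le> t'"
    then show "?g t \<le> ?g t'"
      using first[of "t' - t" "z(l := z l + t)"] by simp
  qed
  moreover have "(?g has_real_derivative D2 k l (z(l := z l + 0))) (at 0)"
    by (intro has_partials_coord[OF D2] assms)
  ultimately have "D2 k l (z(l := z l + 0)) \<ge> 0"
    by (rule mono_on_imp_deriv_nonneg) auto
  then show ?thesis by simp
qed

section \<open>Gaussian product measures and their heat semigroup\<close>

definition std_gauss :: "real measure" where
  "std_gauss = std_normal_distribution"

abbreviation gauss :: "'i set \<Rightarrow> ('i \<Rightarrow> real) measure" where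
  "gauss I \<equiv> PiM I (\<lambda>_. std_gauss)"

lemma sets_std_gauss [simp, measurable_cong]: "sets std_gauss = sets borel"
  by (simp add: std_gauss_def)

lemma space_std_gauss [simp]: "space std_gauss = UNIV"
  by (simp add: std_gauss_def)

lemma prob_space_std_gauss: "prob_space std_gauss"
  unfolding std_gauss_def by (rule prob_space_normal_density) simp

interpretation std_gauss: prob_space std_gauss
  by (rule prob_space_std_gauss)

interpretation gauss: product_prob_space "\<lambda>_. std_gauss" I for I
  by unfold_locales

lemma sets_gauss [measurable_cong]: "sets (gauss I) = sets (PiM I (\<lambda>_. borel))"
  by (intro sets_PiM_cong) auto

lemma measurable_gauss_component:
  "i \<in> I \<Longrightarrow> (\<lambda>w. w i) \<in> borel_measurable (gauss I)"
  using measurable_component_singleton[of i I "\<lambda>_. std_gauss"]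
  by (simp add: measurable_cong_sets[OF refl sets_std_gauss])

lemma distributed_std_gauss:
  assumes "distr M std_gauss X = std_gauss" "X \<in> M \<rightarrow>\<^sub>M std_gauss"
  shows "distributed M lborel X (\<lambda>x. ennreal (normal_density 0 1 x))"
proof -
  have "distr M lborel X = distr M std_gauss X"
    by (rule distr_cong) (auto simp: std_gauss_def)
  then have "distr M lborel X = density lborel (\<lambda>x. ennreal (normal_density 0 1 x))"
    by (simp only: assms(1)) (rule std_gauss_def)
  moreover have "X \<in> measurable M lborel"
    using assms(2) by (simp only: measurable_cong_sets[OF refl sets_std_gauss] measurable_cong_sets[OF refl sets_lborel])
  moreover have "(\<lambda>x. ennreal (normal_density 0 1 x)) \<in> borel_measurable lborel"
    by simp
  ultimately show ?thesis
    unfolding distributed_def by (intro conjI)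
qed

section \<open>Rotation invariance of Gaussian product measures\<close>

lemma std_gauss_scale:
  assumes "c > 0"
  shows "distr std_gauss borel (\<lambda>x. c * x) = density lborel (\<lambda>x. ennreal (normal_density 0 c x))"
proof -
  have "distributed std_gauss lborel (\<lambda>x. x) (\<lambda>x. ennreal (normal_density 0 1 x))"
    by (intro distributed_std_gauss distr_id[unfolded id_def] measurable_ident[unfolded id_def])
  from std_gauss.normal_density_affine[OF this, of c 0]
  have "distributed std_gauss lborel (\<lambda>x. c * x) (\<lambda>x. ennreal (normal_density 0 c x))"
    using assms by simp
  from distributed_distr_eq_density[OF this]
  show ?thesis
    by (rule trans[OF distr_cong, rotated 3]) auto
qed

lemma std_gauss_rotation:
  assumes "a > 0" "b \<ge> 0"
  shows "distr (std_gauss \<Otimes>\<^sub>M std_gauss) borel (\<lambda>x. a * fst x + b * snd x)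
    = distr std_gauss borel (\<lambda>x. sqrt (a\<^sup>2 + b\<^sup>2) * x)"
proof -
  interpret P: pair_prob_space std_gauss std_gauss ..
  let ?P = "std_gauss \<Otimes>\<^sub>M std_gauss"
  have fst: "distr ?P std_gauss fst = std_gauss"
    by (rule std_gauss.distr_pair_fst)
  have "distr ?P std_gauss snd = distr (distr ?P ?P (\<lambda>(x, y). (y, x))) std_gauss snd"
    by (simp add: P.distr_pair_swap[symmetric])
  also have "\<dots> = distr ?P std_gauss fst"
    by (subst distr_distr) (auto simp: o_def case_prod_beta)
  finally have snd: "distr ?P std_gauss snd = std_gauss"
    using fst by simp
  show ?thesis
  \<comment> \<open>The addition law for independent normals asks for positive standard deviations,
    so the degenerate second summand is split off.\<close>
  proof (cases "b = 0")
    case True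
    have "distr ?P borel (\<lambda>x. a * fst x) = distr (distr ?P std_gauss fst) borel (\<lambda>x. a * x)"
      by (subst distr_distr) (auto simp: o_def)
    then show ?thesis using True assms by (simp add: fst)
  next
    case False
    then have "b > 0" using assms by simp
    have "distr ?P borel fst = std_gauss" "distr ?P borel snd = std_gauss"
      using fst snd by (auto cong: distr_cong)
    moreover have "distr ?P (borel \<Otimes>\<^sub>M borel) (\<lambda>x. (fst x, snd x)) = distr ?P ?P (\<lambda>x. x)"
      by (intro distr_cong) (auto intro!: sets_pair_measure_cong)
    ultimately have "P.indep_var borel fst borel snd"
      by (auto simp: P.indep_var_distribution_eq distr_id[unfolded id_def])
    then have "P.indep_var borel ((\<lambda>x. a * x) \<circ> fst) borel ((\<lambda>x. b * x) \<circ> snd)"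
      by (rule P.indep_var_compose) auto
    moreover have "distributed ?P lborel (\<lambda>x. 0 + a * fst x) (normal_density (0 + a * 0) (\<bar>a\<bar> * 1))"
      using \<open>a > 0\<close> fst by (intro P.normal_density_affine distributed_std_gauss) auto
    moreover have "distributed ?P lborel (\<lambda>x. 0 + b * snd x) (normal_density (0 + b * 0) (\<bar>b\<bar> * 1))"
      using \<open>b > 0\<close> snd by (intro P.normal_density_affine distributed_std_gauss) auto
    ultimately have "distributed ?P lborel (\<lambda>x. a * fst x + b * snd x)
        (normal_density (0 + 0) (sqrt (a\<^sup>2 + b\<^sup>2)))"
      using \<open>a > 0\<close> \<open>b > 0\<close> by (intro P.add_indep_normal) (auto simp: o_def)
    then have "distr ?P lborel (\<lambda>x. a * fst x + b * snd x)
        = density lborel (\<lambda>x. ennreal (normal_density 0 (sqrt (a\<^sup>2 + b\<^sup>2)) x))"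
      by (simp add: distributed_def)
    also have "\<dots> = distr std_gauss borel (\<lambda>x. sqrt (a\<^sup>2 + b\<^sup>2) * x)"
      using \<open>a > 0\<close> by (intro std_gauss_scale[symmetric] real_sqrt_gt_zero add_pos_nonneg) auto
    finally show ?thesis
      by (rule trans[OF distr_cong, rotated 3]) auto
  qed
qed

text \<open>A product measure is determined by its values on boxes. The indicator of a box factors
  over the coordinates, so Fubini reduces the claim to \<open>std_gauss_rotation\<close> in each
  coordinate.\<close>

lemma gauss_rotation:
  fixes I :: "'i set"
  assumes I: "finite I" and ab: "a > 0" "b \<ge> 0"
  shows "distr (gauss I \<Otimes>\<^sub>M gauss I) (PiM I (\<lambda>_. borel)) (\<lambda>(u, v). \<lambda>i\<in>I. a * u i + b * v i)
    = PiM I (\<lambda>_. distr std_gauss borel (\<lambda>x. sqrt (a\<^sup>2 + b\<^sup>2) * x))"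
    (is "distr ?P _ ?f = PiM I (\<lambda>_. ?N)")
proof -
  interpret N: prob_space ?N
    by (intro std_gauss.prob_space_distr) auto
  interpret NP: product_prob_space "\<lambda>_. ?N" I ..
  interpret GG: pair_prob_space "gauss I" "gauss I" ..
  have [measurable]: "?f \<in> ?P \<rightarrow>\<^sub>M PiM I (\<lambda>_. borel)"
    by measurable
  show ?thesis
  proof (rule NP.PiM_eqI[OF I])
    show "sets (distr ?P (PiM I (\<lambda>_. borel)) ?f) = sets (PiM I (\<lambda>_. ?N))"
      by (auto intro!: sets_PiM_cong)
    fix A :: "'i \<Rightarrow> real set" assume "\<And>i. i \<in> I \<Longrightarrow> A i \<in> sets ?N"
    then have A [measurable]: "\<And>i. i \<in> I \<Longrightarrow> A i \<in> sets borel" by simp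
    have PA [measurable]: "Pi\<^sub>E I A \<in> sets (PiM I (\<lambda>_. borel))"
      by (intro sets_PiM_I_finite I A)
    have prod_ind: "indicator (Pi\<^sub>E I A) (?f (u, v)) = (\<Prod>i\<in>I. indicator (A i) (a * u i + b * v i) :: ennreal)" for u v
    proof -
      have "?f (u, v) \<in> Pi\<^sub>E I A \<longleftrightarrow> (\<forall>i\<in>I. a * u i + b * v i \<in> A i)"
        by (auto simp: PiE_iff)
      then show ?thesis
        using I by (auto simp: indicator_def prod_eq_1_iff prod_zero_iff)
    qed
    have "emeasure (distr ?P (PiM I (\<lambda>_. borel)) ?f) (Pi\<^sub>E I A)
        = (\<integral>\<^sup>+z. indicator (Pi\<^sub>E I A) (?f z) \<partial>?P)"
      by (subst nn_integral_indicator[symmetric], simp, intro nn_integral_distr) measurable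
    also have "\<dots> = (\<integral>\<^sup>+u. \<integral>\<^sup>+v. indicator (Pi\<^sub>E I A) (?f (u, v)) \<partial>gauss I \<partial>gauss I)"
      by (rule gauss.P.nn_integral_fst[symmetric]) measurable
    also have "\<dots> = (\<integral>\<^sup>+u. \<integral>\<^sup>+v. (\<Prod>i\<in>I. indicator (A i) (a * u i + b * v i)) \<partial>gauss I \<partial>gauss I)"
      by (simp only: prod_ind)
    also have "\<dots> = (\<integral>\<^sup>+u. (\<Prod>i\<in>I. \<integral>\<^sup>+y. indicator (A i) (a * u i + b * y) \<partial>std_gauss) \<partial>gauss I)"
      by (intro nn_integral_cong gauss.product_nn_integral_prod I) measurable
    also have "\<dots> = (\<Prod>i\<in>I. \<integral>\<^sup>+x. \<integral>\<^sup>+y. indicator (A i) (a * x + b * y) \<partial>std_gauss \<partial>std_gauss)"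
      by (intro gauss.product_nn_integral_prod I) measurable
    also have "\<dots> = (\<Prod>i\<in>I. emeasure ?N (A i))"
    proof (intro prod.cong refl)
      fix i assume [measurable]: "i \<in> I"
      have "(\<integral>\<^sup>+x. \<integral>\<^sup>+y. indicator (A i) (a * x + b * y) \<partial>std_gauss \<partial>std_gauss)
          = (\<integral>\<^sup>+x. \<integral>\<^sup>+y. indicator (A i) (a * fst (x, y) + b * snd (x, y)) \<partial>std_gauss \<partial>std_gauss)"
        by simp
      also have "\<dots> = (\<integral>\<^sup>+z. indicator (A i) (a * fst z + b * snd z) \<partial>(std_gauss \<Otimes>\<^sub>M std_gauss))"
        by (rule std_gauss.nn_integral_fst) measurable
      also have "\<dots> = emeasure (distr (std_gauss \<Otimes>\<^sub>M std_gauss) borel (\<lambda>z. a * fst z + b * snd z)) (A i)"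
        using A[OF \<open>i \<in> I\<close>]
        by (subst nn_integral_indicator[symmetric], simp, intro nn_integral_distr[symmetric]) measurable
      finally show "(\<integral>\<^sup>+x. \<integral>\<^sup>+y. indicator (A i) (a * x + b * y) \<partial>std_gauss \<partial>std_gauss) = emeasure ?N (A i)"
        by (simp add: std_gauss_rotation[OF ab])
    qed
    finally show "emeasure (distr ?P (PiM I (\<lambda>_. borel)) ?f) (Pi\<^sub>E I A) = (\<Prod>i\<in>I. emeasure ?N (A i))" .
  qed
qed

lemma prob_space_gauss: "prob_space (gauss I)"
  by (rule prob_space_PiM) (rule prob_space_std_gauss)

lemma gauss_rotation_integral:
  fixes h :: "('i \<Rightarrow> real) \<Rightarrow> real"
  assumes I: "finite I" and ab: "a > 0" "b \<ge> 0"
    and h [measurable]: "h \<in> borel_measurable (PiM I (\<lambda>_. borel))" and C: "\<And>w. \<bar>h w\<bar> \<le> C"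
  shows "(\<integral>u. \<integral>v. h (\<lambda>i\<in>I. a * u i + b * v i) \<partial>gauss I \<partial>gauss I)
    = (\<integral>w. h (\<lambda>i\<in>I. sqrt (a\<^sup>2 + b\<^sup>2) * w i) \<partial>gauss I)"
proof -
  interpret GG: pair_prob_space "gauss I" "gauss I" ..
  let ?P = "gauss I \<Otimes>\<^sub>M gauss I"
  let ?N = "\<lambda>c. PiM I (\<lambda>_. distr std_gauss borel (\<lambda>x. c * x))"
  have main: "(\<integral>u. \<integral>v. h (\<lambda>i\<in>I. a * u i + b * v i) \<partial>gauss I \<partial>gauss I)
      = (\<integral>w. h w \<partial>?N (sqrt (a\<^sup>2 + b\<^sup>2)))"
    if ab: "a > 0" "b \<ge> 0" for a b
  proof -
    let ?f = "\<lambda>(u, v). \<lambda>i\<in>I. a * u i + b * v i"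
    have f [measurable]: "?f \<in> ?P \<rightarrow>\<^sub>M PiM I (\<lambda>_. borel)"
      by measurable
    have "integrable ?P (\<lambda>z. h (?f z))"
      by (rule GG.integrable_const_bound[where B=C]) (auto simp: C)
    from GG.integral_fst'[OF this]
    have "(\<integral>u. \<integral>v. h (?f (u, v)) \<partial>gauss I \<partial>gauss I) = (\<integral>z. h (?f z) \<partial>?P)" .
    also have "\<dots> = (\<integral>w. h w \<partial>distr ?P (PiM I (\<lambda>_. borel)) ?f)"
      by (rule integral_distr[symmetric, OF f h])
    finally show ?thesis by (simp add: gauss_rotation[OF I ab])
  qed
  \<comment> \<open>Taking the second scale to be 0 in \<open>main\<close> identifies the product of
    scaled Gaussians with the scaled standard Gaussian, which turns the right-hand side of
    \<open>main\<close> back into an integral over \<open>gauss I\<close>.\<close>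
  have "(\<integral>w. h (\<lambda>i\<in>I. c * w i) \<partial>gauss I) = (\<integral>w. h w \<partial>?N c)" if "c > 0" for c
    using main[of c 0] that by (simp add: gauss.P.prob_space)
  then show ?thesis using main[OF ab] ab by (simp add: add_pos_nonneg)
qed

text \<open>The points of the product space over \<open>K\<close> are extensional, while
  \<open>F\<close> is applied to arbitrary functions on the whole index type. Invariance under
  \<open>restrict\<close> links the two and makes \<open>F\<close> a function of the coordinates in
  \<open>K\<close>.\<close>

definition cylindrical :: "'k set \<Rightarrow> (('k \<Rightarrow> real) \<Rightarrow> real) \<Rightarrow> bool" where
  "cylindrical K F \<longleftrightarrow> F \<in> borel_measurable (PiM K (\<lambda>_. borel)) \<and> (\<forall>z. F (restrict z K) = F z)"

lemma cylindrical_measurable: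
  assumes F: "cylindrical K F" and X: "\<And>k. k \<in> K \<Longrightarrow> X k \<in> borel_measurable N"
  shows "(\<lambda>w. F (\<lambda>k. X k w)) \<in> borel_measurable N"
proof -
  have [measurable]: "F \<in> borel_measurable (PiM K (\<lambda>_. borel))"
    using F by (simp add: cylindrical_def)
  have "(\<lambda>w. F (\<lambda>k\<in>K. X k w)) \<in> borel_measurable N"
    by (rule measurable_compose[OF measurable_restrict]) (use X in auto)
  moreover have "F (\<lambda>k\<in>K. X k w) = F (\<lambda>k. X k w)" for w
    using F by (simp add: cylindrical_def)
  ultimately show ?thesis by simp
qed

section \<open>Gaussian linear forms and their heat operators\<close>

definition lin :: "'i set \<Rightarrow> ('k \<Rightarrow> 'i \<Rightarrow> real) \<Rightarrow> ('i \<Rightarrow> real) \<Rightarrow> 'k \<Rightarrow> real" where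
  "lin I A w k = (\<Sum>i\<in>I. A k i * w i)"

lemma measurable_lin:
  "X \<in> N \<rightarrow>\<^sub>M gauss I \<Longrightarrow> (\<lambda>z. lin I A (X z) k) \<in> borel_measurable N"
  unfolding lin_def
  by (intro borel_measurable_sum borel_measurable_times borel_measurable_const
      measurable_compose[OF _ measurable_gauss_component])

text \<open>The heat semigroup of the covariance \<open>(\<Sum>i\<in>I. A k i * A l i)\<close> at
  time \<open>t * t\<close>. The parameter \<open>t\<close> is a standard deviation, so two scales
  compose to \<open>sqrt (a\<^sup>2 + b\<^sup>2)\<close>.\<close>

definition heat ::
  "'i set \<Rightarrow> ('k \<Rightarrow> 'i \<Rightarrow> real) \<Rightarrow> real \<Rightarrow> (('k \<Rightarrow> real) \<Rightarrow> real) \<Rightarrow> ('k \<Rightarrow> real) \<Rightarrow> real" where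
  "heat I A t F s = (\<integral>w. F (\<lambda>k. s k + t * lin I A w k) \<partial>gauss I)"

lemma heat_0: "heat I A 0 F s = F s"
proof -
  show ?thesis by (simp add: heat_def gauss.P.prob_space)
qed

lemma integrable_heat:
  assumes F: "cylindrical K F" and C: "\<And>z. \<bar>F z\<bar> \<le> C"
  shows "integrable (gauss I) (\<lambda>w. F (\<lambda>k. s k + t * lin I A w k))"
proof -
  have "(\<lambda>w. F (\<lambda>k. s k + t * lin I A w k)) \<in> borel_measurable (gauss I)"
    by (rule cylindrical_measurable[OF F])
       (intro borel_measurable_add borel_measurable_times borel_measurable_const measurable_lin measurable_ident_sets refl)
  then show ?thesis
    by (intro gauss.P.integrable_const_bound[where B=C]) (auto simp: C)
qed

lemma measurable_heat2:
  assumes F: "cylindrical K F"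
  shows "(\<lambda>z. F (\<lambda>k. s k + a * lin I A (fst z) k + b * lin I B (snd z) k))
    \<in> borel_measurable (gauss I \<Otimes>\<^sub>M gauss I)"
  by (rule cylindrical_measurable[OF F])
     (intro borel_measurable_add borel_measurable_times borel_measurable_const measurable_lin measurable_fst measurable_snd)

lemma integrable_heat_shift:
  assumes F: "cylindrical K F" and C: "\<And>z. \<bar>F z\<bar> \<le> C"
  shows "integrable (gauss I) (\<lambda>w. heat I B b F (\<lambda>k. s k + a * lin I A w k))"
proof -
  interpret GG: pair_prob_space "gauss I" "gauss I" ..
  have "integrable (gauss I \<Otimes>\<^sub>M gauss I) (\<lambda>z. F (\<lambda>k. s k + a * lin I A (fst z) k + b * lin I B (snd z) k))"
    by (intro GG.integrable_const_bound[where B=C] measurable_heat2[OF F]) (auto simp: C)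
  from GG.integrable_fst'[OF this] show ?thesis by (simp add: heat_def)
qed

text \<open>By Fubini, the independent noises with coefficients \<open>A\<close> and
  \<open>B\<close> may be added in either order. This allows a single copy to be exchanged while the
  others are held fixed.\<close>

lemma heat_commute:
  assumes F: "cylindrical K F" and C: "\<And>z. \<bar>F z\<bar> \<le> C"
  shows "(\<integral>w. heat I B b F (\<lambda>k. s k + a * lin I A w k) \<partial>gauss I)
    = (\<integral>w. heat I A a F (\<lambda>k. s k + b * lin I B w k) \<partial>gauss I)"
proof -
  interpret GG: pair_prob_space "gauss I" "gauss I" ..
  have "integrable (gauss I \<Otimes>\<^sub>M gauss I) (\<lambda>z. F (\<lambda>k. s k + a * lin I A (fst z) k + b * lin I B (snd z) k))"
    by (intro GG.integrable_const_bound[where B=C] measurable_heat2[OF F]) (auto simp: C)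
  then have "integrable (gauss I \<Otimes>\<^sub>M gauss I)
     (case_prod (\<lambda>u v. F (\<lambda>k. s k + a * lin I A u k + b * lin I B v k)))"
    by (simp add: case_prod_beta')
  from GG.Fubini_integral[OF this] show ?thesis
    by (simp add: heat_def add_ac)
qed

text \<open>Two independent copies at scales \<open>a\<close> and \<open>b\<close> add up to one
  copy at scale \<open>sqrt (a\<^sup>2 + b\<^sup>2)\<close>, by rotation invariance of the
  underlying Gaussian vector.\<close>

lemma heat_semigroup:
  assumes I: "finite I" and F: "cylindrical K F" and C: "\<And>z. \<bar>F z\<bar> \<le> C" and ab: "a > 0" "b \<ge> 0"
  shows "(\<integral>w. heat I A b F (\<lambda>k. s k + a * lin I A w k) \<partial>gauss I) = heat I A (sqrt (a\<^sup>2 + b\<^sup>2)) F s"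
proof -
  let ?h = "\<lambda>w. F (\<lambda>k. s k + lin I A w k)"
  have "?h \<in> borel_measurable (PiM I (\<lambda>_. borel))"
    by (rule cylindrical_measurable[OF F]) (auto simp: lin_def)
  from gauss_rotation_integral[OF I ab this C]
  show ?thesis
    by (simp add: heat_def lin_def sum_distrib_left distrib_left sum.distrib mult.left_commute add_ac)
qed

section \<open>Gaussian comparison\<close>

lemma distr_gauss_component: "i \<in> I \<Longrightarrow> distr (gauss I) std_gauss (\<lambda>w. w i) = std_gauss"
  by (rule distr_PiM_component) (auto intro: prob_space_std_gauss)

lemma gauss_component_integral:
  fixes f :: "real \<Rightarrow> real"
  assumes i: "i \<in> I" and f: "integrable std_gauss f"
  shows "integrable (gauss I) (\<lambda>w. f (w i))" "(\<integral>w. f (w i) \<partial>gauss I) = (\<integral>x. f x \<partial>std_gauss)"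
proof -
  have m: "(\<lambda>w. w i) \<in> gauss I \<rightarrow>\<^sub>M std_gauss"
    using i by (rule measurable_component_singleton)
  show "integrable (gauss I) (\<lambda>w. f (w i))"
    by (rule integrable_distr[OF m]) (simp add: distr_gauss_component i f)
  have "(\<integral>w. f (w i) \<partial>gauss I) = (\<integral>x. f x \<partial>distr (gauss I) std_gauss (\<lambda>w. w i))"
    using f by (intro integral_distr[symmetric] m) auto
  then show "(\<integral>w. f (w i) \<partial>gauss I) = (\<integral>x. f x \<partial>std_gauss)"
    by (simp add: distr_gauss_component i)
qed

lemma gauss_two_component_integral:
  fixes f :: "real \<Rightarrow> real"
  assumes I: "finite I" "i \<in> I" "j \<in> I" "i \<noteq> j" and f: "integrable std_gauss f"
  shows "integrable (gauss I) (\<lambda>w. f (w i) * f (w j))"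
    "(\<integral>w. f (w i) * f (w j) \<partial>gauss I) = (\<integral>x. f x \<partial>std_gauss)\<^sup>2"
proof -
  \<comment> \<open>Padding with the constant 1 turns the product of two factors into a product over
    all of \<open>I\<close>, to which the integral formula for product measures applies.\<close>
  define g where "g k = (if k \<in> {i, j} then f else (\<lambda>_. 1))" for k
  have g: "integrable std_gauss (g k)" for k
    using f by (simp add: g_def)
  have "(\<Prod>k\<in>I. g k (w k)) = (\<Prod>k\<in>{i, j}. f (w k))" for w
    using I by (intro prod.mono_neutral_cong_right) (auto simp: g_def)
  then have eq: "(\<Prod>k\<in>I. g k (w k)) = f (w i) * f (w j)" for w
    using I by simp
  show "integrable (gauss I) (\<lambda>w. f (w i) * f (w j))"
    using gauss.product_integrable_prod[OF I(1), of g] g by (simp add: eq)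
  have "(\<integral>w. f (w i) * f (w j) \<partial>gauss I) = (\<Prod>k\<in>I. \<integral>x. g k x \<partial>std_gauss)"
    using gauss.product_integral_prod[OF I(1), of g] g by (simp add: eq)
  also have "\<dots> = (\<Prod>k\<in>{i, j}. \<integral>x. f x \<partial>std_gauss)"
    using I by (intro prod.mono_neutral_cong_right) (auto simp: g_def std_gauss.prob_space[simplified])
  finally show "(\<integral>w. f (w i) * f (w j) \<partial>gauss I) = (\<integral>x. f x \<partial>std_gauss)\<^sup>2"
    using I by (simp add: power2_eq_square)
qed

text \<open>Off-diagonal terms vanish by independence and centering. A general centred
  \<open>f\<close> is allowed because the result serves twice: for the linear forms
  \<open>lin\<close>, with the identity, and for the decoupled variable, with the centred absolute
  value.\<close>

lemma gauss_linear_moments: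
  fixes f :: "real \<Rightarrow> real"
  assumes I: "finite I" and f: "integrable std_gauss f" "integrable std_gauss (\<lambda>x. (f x)\<^sup>2)"
    and zero: "(\<integral>x. f x \<partial>std_gauss) = 0"
  shows "integrable (gauss I) (\<lambda>w. \<Sum>i\<in>I. c i * f (w i))"
    "(\<integral>w. (\<Sum>i\<in>I. c i * f (w i)) \<partial>gauss I) = 0"
    "integrable (gauss I) (\<lambda>w. (\<Sum>i\<in>I. c i * f (w i)) * (\<Sum>i\<in>I. d i * f (w i)))"
    "(\<integral>w. (\<Sum>i\<in>I. c i * f (w i)) * (\<Sum>i\<in>I. d i * f (w i)) \<partial>gauss I)
      = (\<Sum>i\<in>I. c i * d i) * (\<integral>x. (f x)\<^sup>2 \<partial>std_gauss)"
proof -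
  have 1: "integrable (gauss I) (\<lambda>w. c i * f (w i))" if "i \<in> I" for i
    using gauss_component_integral(1)[OF that f(1)] by simp
  show "integrable (gauss I) (\<lambda>w. \<Sum>i\<in>I. c i * f (w i))"
    using 1 by (rule Bochner_Integration.integrable_sum)
  show "(\<integral>w. (\<Sum>i\<in>I. c i * f (w i)) \<partial>gauss I) = 0"
    using 1 by (subst Bochner_Integration.integral_sum)
      (auto intro!: sum.neutral simp: gauss_component_integral(2)[OF _ f(1)] zero)
  have 2: "integrable (gauss I) (\<lambda>w. f (w i) * f (w j))"
    "(\<integral>w. f (w i) * f (w j) \<partial>gauss I) = (if i = j then \<integral>x. (f x)\<^sup>2 \<partial>std_gauss else 0)"
    if "i \<in> I" "j \<in> I" for i j
    using gauss_component_integral[OF that(1) f(2)] gauss_two_component_integral[OF I that _ f(1)] zero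
    by (cases "i = j"; simp add: power2_eq_square)+
  have expand: "(\<Sum>i\<in>I. c i * f (w i)) * (\<Sum>i\<in>I. d i * f (w i))
      = (\<Sum>i\<in>I. \<Sum>j\<in>I. c i * d j * (f (w i) * f (w j)))" for w
    by (simp add: sum_product mult_ac)
  have 3: "integrable (gauss I) (\<lambda>w. c i * d j * (f (w i) * f (w j)))" if "i \<in> I" "j \<in> I" for i j
    using 2(1)[OF that] by simp
  show "integrable (gauss I) (\<lambda>w. (\<Sum>i\<in>I. c i * f (w i)) * (\<Sum>i\<in>I. d i * f (w i)))"
    unfolding expand using 3 by (intro Bochner_Integration.integrable_sum)
  have "(\<integral>w. (\<Sum>i\<in>I. c i * f (w i)) * (\<Sum>i\<in>I. d i * f (w i)) \<partial>gauss I)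
      = (\<Sum>i\<in>I. \<integral>w. (\<Sum>j\<in>I. c i * d j * (f (w i) * f (w j))) \<partial>gauss I)"
    unfolding expand using 3 by (intro Bochner_Integration.integral_sum Bochner_Integration.integrable_sum)
  also have "\<dots> = (\<Sum>i\<in>I. \<Sum>j\<in>I. \<integral>w. c i * d j * (f (w i) * f (w j)) \<partial>gauss I)"
    using 3 by (intro sum.cong refl Bochner_Integration.integral_sum)
  also have "\<dots> = (\<Sum>i\<in>I. \<Sum>j\<in>I. c i * d j * (if i = j then \<integral>x. (f x)\<^sup>2 \<partial>std_gauss else 0))"
    by (intro sum.cong refl) (simp add: 2(2))
  also have "\<dots> = (\<Sum>i\<in>I. c i * d i) * (\<integral>x. (f x)\<^sup>2 \<partial>std_gauss)"
    using I by (simp add: if_distrib[where f="\<lambda>x. _ * x"] sum_distrib_right cong: if_cong)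
  finally show "(\<integral>w. (\<Sum>i\<in>I. c i * f (w i)) * (\<Sum>i\<in>I. d i * f (w i)) \<partial>gauss I)
      = (\<Sum>i\<in>I. c i * d i) * (\<integral>x. (f x)\<^sup>2 \<partial>std_gauss)" .
qed

lemma std_gauss_moments:
  "integrable std_gauss (\<lambda>x. x ^ k)" "(\<integral>x. x \<partial>std_gauss) = 0" "(\<integral>x. x\<^sup>2 \<partial>std_gauss) = 1"
  "(\<integral>x. \<bar>x\<bar> \<partial>std_gauss) = sqrt (2 / pi)"
  using integrable_std_normal_distribution_moment[of k]
    integral_std_normal_distribution_moment_odd[of 1] std_normal_distribution_even_moments(1)[of 1]
    std_normal_distribution_odd_moments_abs[of 0]
  by (simp_all add: std_gauss_def)

lemma integrable_std_gauss_abs_power: "integrable std_gauss (\<lambda>x. \<bar>x\<bar> ^ k)"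
  using integrable_abs[OF std_gauss_moments(1)[of k]] by (simp add: power_abs)

lemma lin_moments:
  assumes I: "finite I"
  shows "integrable (gauss I) (\<lambda>w. lin I A w k)" "(\<integral>w. lin I A w k \<partial>gauss I) = 0"
    "integrable (gauss I) (\<lambda>w. lin I A w k * lin I A w l)"
    "(\<integral>w. lin I A w k * lin I A w l \<partial>gauss I) = (\<Sum>i\<in>I. A k i * A l i)"
  using gauss_linear_moments[OF I, of "\<lambda>x. x"] std_gauss_moments(1)[of 1] std_gauss_moments
  by (simp_all add: lin_def)

text \<open>Every summand is at most the largest one, whose cube is a single term of the sum on the
  right.\<close>

lemma sum_cubed_le:
  fixes f :: "'a \<Rightarrow> real"
  assumes I: "finite I" and f: "\<And>i. i \<in> I \<Longrightarrow> f i \<ge> 0"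
  shows "(\<Sum>i\<in>I. f i) ^ 3 \<le> real (card I) ^ 3 * (\<Sum>i\<in>I. f i ^ 3)"
proof (cases "I = {}")
  case False
  then have "Max (f ` I) \<in> f ` I" using I by (intro Max_in) auto
  then obtain m where m: "m \<in> I" "Max (f ` I) = f m" by auto
  have le: "(\<Sum>i\<in>I. f i) \<le> real (card I) * f m"
    using I m by (intro sum_bounded_above) (metis Max_ge finite_imageI imageI)
  have "(\<Sum>i\<in>I. f i) ^ 3 \<le> (real (card I) * f m) ^ 3"
    using f by (intro power_mono le sum_nonneg)
  also have "\<dots> \<le> real (card I) ^ 3 * (\<Sum>i\<in>I. f i ^ 3)"
    unfolding power_mult_distrib using I m f
    by (intro mult_left_mono member_le_sum[where f="\<lambda>i. f i ^ 3"]) auto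
  finally show ?thesis .
qed simp

text \<open>The third absolute moment controls the Taylor remainder after integration.\<close>

lemma integrable_lin_cubed:
  assumes I: "finite I" and K: "finite K"
  shows "integrable (gauss I) (\<lambda>w. (\<Sum>k\<in>K. \<bar>lin I A w k\<bar>) ^ 3)"
proof (rule Bochner_Integration.integrable_bound)
  define a where "a = (\<Sum>k\<in>K. \<Sum>i\<in>I. \<bar>A k i\<bar>)"
  have a: "a \<ge> 0" unfolding a_def by (intro sum_nonneg) auto
  show "integrable (gauss I) (\<lambda>w. a ^ 3 * (real (card I) ^ 3 * (\<Sum>i\<in>I. \<bar>w i\<bar> ^ 3)))"
    by (intro integrable_mult_right Bochner_Integration.integrable_sum
        gauss_component_integral(1) integrable_std_gauss_abs_power)
  show "(\<lambda>w. (\<Sum>k\<in>K. \<bar>lin I A w k\<bar>) ^ 3) \<in> borel_measurable (gauss I)"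
    by (intro borel_measurable_power borel_measurable_sum borel_measurable_abs measurable_lin
        measurable_ident_sets refl)
  show "AE w in gauss I. norm ((\<Sum>k\<in>K. \<bar>lin I A w k\<bar>) ^ 3)
      \<le> norm (a ^ 3 * (real (card I) ^ 3 * (\<Sum>i\<in>I. \<bar>w i\<bar> ^ 3)))"
  proof (rule AE_I2)
    fix w
    have "(\<Sum>k\<in>K. \<bar>lin I A w k\<bar>) \<le> (\<Sum>k\<in>K. \<Sum>i\<in>I. \<bar>A k i\<bar> * (\<Sum>i\<in>I. \<bar>w i\<bar>))"
      unfolding lin_def
    proof (intro sum_mono order_trans[OF sum_abs])
      fix k i assume "i \<in> I"
      then have "\<bar>w i\<bar> \<le> (\<Sum>i\<in>I. \<bar>w i\<bar>)" using I by (intro member_le_sum) auto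
      then show "\<bar>A k i * w i\<bar> \<le> \<bar>A k i\<bar> * (\<Sum>i\<in>I. \<bar>w i\<bar>)"
        by (simp add: abs_mult mult_left_mono)
    qed
    also have "\<dots> = a * (\<Sum>i\<in>I. \<bar>w i\<bar>)"
      by (simp add: a_def sum_distrib_right)
    finally have "(\<Sum>k\<in>K. \<bar>lin I A w k\<bar>) ^ 3 \<le> (a * (\<Sum>i\<in>I. \<bar>w i\<bar>)) ^ 3"
      by (intro power_mono sum_nonneg) auto
    also have "\<dots> \<le> a ^ 3 * (real (card I) ^ 3 * (\<Sum>i\<in>I. \<bar>w i\<bar> ^ 3))"
      unfolding power_mult_distrib using a by (intro mult_left_mono sum_cubed_le I) auto
    finally show "norm ((\<Sum>k\<in>K. \<bar>lin I A w k\<bar>) ^ 3)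
        \<le> norm (a ^ 3 * (real (card I) ^ 3 * (\<Sum>i\<in>I. \<bar>w i\<bar> ^ 3)))"
      by (simp add: abs_of_nonneg sum_nonneg)
  qed
qed

text \<open>Integrating the Taylor expansion against the Gaussian noise removes the first-order
  term, since the noise is centred, and turns the products in the second-order term into
  covariances. The remainder scales as the cube of \<open>t\<close>.\<close>

lemma heat_taylor:
  assumes I: "finite I" and K: "finite K" and F: "cylindrical K F" and bound: "\<And>z. \<bar>F z\<bar> \<le> B"
    and C: "C \<ge> 0" and taylor: "\<And>s v. \<bar>F (\<lambda>k. s k + v k) - F s - (\<Sum>k\<in>K. v k * D1 k s)
       - (\<Sum>k\<in>K. \<Sum>l\<in>K. v k * v l * D2 k l s) / 2\<bar> \<le> C * (\<Sum>k\<in>K. \<bar>v k\<bar>) ^ 3"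
    and t: "t \<ge> 0"
  shows "\<bar>heat I A t F s - F s - t\<^sup>2 / 2 * (\<Sum>k\<in>K. \<Sum>l\<in>K. (\<Sum>i\<in>I. A k i * A l i) * D2 k l s)\<bar>
    \<le> C * (\<integral>w. (\<Sum>k\<in>K. \<bar>lin I A w k\<bar>) ^ 3 \<partial>gauss I) * t ^ 3"
proof -
  let ?v = "\<lambda>w k. t * lin I A w k"
  let ?T = "\<lambda>w. (\<Sum>k\<in>K. ?v w k * D1 k s)"
  let ?S = "\<lambda>w. (\<Sum>k\<in>K. \<Sum>l\<in>K. ?v w k * ?v w l * D2 k l s) / 2"
  let ?G = "\<lambda>w. F (\<lambda>k. s k + ?v w k)"
  have G: "integrable (gauss I) ?G"
    by (rule integrable_heat[OF F bound])
  have T1: "integrable (gauss I) (\<lambda>w. ?v w k * D1 k s)" for k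
    by (simp add: lin_moments(1)[OF I])
  have T: "integrable (gauss I) ?T" "(\<integral>w. ?T w \<partial>gauss I) = 0"
    using T1 by (auto simp: lin_moments(2)[OF I] Bochner_Integration.integral_sum)
  have S_eq: "?S = (\<lambda>w. t\<^sup>2 / 2 * (\<Sum>k\<in>K. \<Sum>l\<in>K. (lin I A w k * lin I A w l) * D2 k l s))"
    by (simp add: fun_eq_iff sum_distrib_left power2_eq_square mult_ac sum_divide_distrib)
  have S1: "integrable (gauss I) (\<lambda>w. (lin I A w k * lin I A w l) * D2 k l s)" for k l
    by (simp add: lin_moments(3)[OF I])
  have S: "integrable (gauss I) ?S" 
    "(\<integral>w. ?S w \<partial>gauss I) = t\<^sup>2 / 2 * (\<Sum>k\<in>K. \<Sum>l\<in>K. (\<Sum>i\<in>I. A k i * A l i) * D2 k l s)"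
    unfolding S_eq using S1
    by (auto simp: lin_moments(4)[OF I] Bochner_Integration.integral_sum)
  have R: "integrable (gauss I) (\<lambda>w. C * (\<Sum>k\<in>K. \<bar>?v w k\<bar>) ^ 3)"
    "(\<integral>w. C * (\<Sum>k\<in>K. \<bar>?v w k\<bar>) ^ 3 \<partial>gauss I)
      = C * (\<integral>w. (\<Sum>k\<in>K. \<bar>lin I A w k\<bar>) ^ 3 \<partial>gauss I) * t ^ 3"
    using t integrable_lin_cubed[OF I K, of A]
    by (auto simp: abs_mult sum_distrib_left[symmetric] power_mult_distrib)
  have eq: "heat I A t F s - F s - t\<^sup>2 / 2 * (\<Sum>k\<in>K. \<Sum>l\<in>K. (\<Sum>i\<in>I. A k i * A l i) * D2 k l s)
      = (\<integral>w. ?G w - F s - ?T w - ?S w \<partial>gauss I)"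
    using G T S by (simp add: heat_def gauss.P.prob_space)
  have le: "\<bar>\<integral>w. ?G w - F s - ?T w - ?S w \<partial>gauss I\<bar> \<le> (\<integral>w. C * (\<Sum>k\<in>K. \<bar>?v w k\<bar>) ^ 3 \<partial>gauss I)"
  proof (rule order_trans[OF integral_abs_bound], rule integral_mono)
    show "integrable (gauss I) (\<lambda>w. \<bar>?G w - F s - ?T w - ?S w\<bar>)"
      using G T(1) S(1) by (intro integrable_abs Bochner_Integration.integrable_diff) auto
  qed (use R taylor in auto)
  show ?thesis using le unfolding eq R(2) .
qed

text \<open>The noise at scale 1 is split into \<open>n\<close> independent copies at scale
  \<open>1 / sqrt n\<close>, exchanged one at a time. The alternatives in \<open>cov\<close> ensure
  that each exchange has a second-order effect of the right sign: either the covariances agree, or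
  the larger one meets a nonnegative mixed partial.\<close>

theorem gaussian_comparison:
  fixes A B :: "'k \<Rightarrow> 'i \<Rightarrow> real"
  assumes I: "finite I" and K: "finite K" and F: "cylindrical K F" and smooth: "bounded_smooth 3 K F"
    and cov: "\<And>k l. k \<in> K \<Longrightarrow> l \<in> K \<Longrightarrow> (\<Sum>i\<in>I. A k i * A l i) = (\<Sum>i\<in>I. B k i * B l i)
      \<or> (\<Sum>i\<in>I. A k i * A l i) \<ge> (\<Sum>i\<in>I. B k i * B l i) \<and> k \<noteq> l \<and> supermodular_in k l F"
  shows "heat I A 1 F s \<ge> heat I B 1 F s"
proof -
  obtain b where b: "\<And>z. \<bar>F z\<bar> \<le> b"
    using bounded_smooth_bounded[OF smooth] by blast
  obtain D1 D2 C where D: "has_partials K F D1" "\<And>k. k \<in> K \<Longrightarrow> has_partials K (D1 k) (D2 k)" "C \<ge> 0"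
    "\<And>s v. \<bar>F (\<lambda>k. s k + v k) - F s - (\<Sum>k\<in>K. v k * D1 k s)
       - (\<Sum>k\<in>K. \<Sum>l\<in>K. v k * v l * D2 k l s) / 2\<bar> \<le> C * (\<Sum>k\<in>K. \<bar>v k\<bar>) ^ 3"
    using bounded_smooth_taylor[OF K smooth] by blast
  define c where "c = C * (\<integral>w. (\<Sum>k\<in>K. \<bar>lin I A w k\<bar>) ^ 3 \<partial>gauss I)
    + C * (\<integral>w. (\<Sum>k\<in>K. \<bar>lin I B w k\<bar>) ^ 3 \<partial>gauss I)"
  \<comment> \<open>One exchange. The constant \<open>c\<close> depends neither on \<open>t\<close>
    nor on the base point \<open>s\<close>, so the error is the same at every stage.\<close>
  have step: "heat I A t F s \<ge> heat I B t F s - c * t ^ 3" if t: "t \<ge> 0" for t s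
  proof -
    have "(\<Sum>k\<in>K. \<Sum>l\<in>K. (\<Sum>i\<in>I. A k i * A l i) * D2 k l s)
        \<ge> (\<Sum>k\<in>K. \<Sum>l\<in>K. (\<Sum>i\<in>I. B k i * B l i) * D2 k l s)"
    proof (intro sum_mono)
      fix k l assume kl: "k \<in> K" "l \<in> K"
      have "0 \<le> D2 k l s" if "k \<noteq> l" "supermodular_in k l F"
        by (rule supermodular_in_second_partial_nonneg[of K k l F D1 D2]) (use K kl that D in auto)
      then show "(\<Sum>i\<in>I. B k i * B l i) * D2 k l s \<le> (\<Sum>i\<in>I. A k i * A l i) * D2 k l s"
        using cov[OF kl] by (auto intro: mult_right_mono)
    qed
    from mult_left_mono[OF this, of "t\<^sup>2 / 2"]
    have "t\<^sup>2 / 2 * (\<Sum>k\<in>K. \<Sum>l\<in>K. (\<Sum>i\<in>I. B k i * B l i) * D2 k l s)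
        \<le> t\<^sup>2 / 2 * (\<Sum>k\<in>K. \<Sum>l\<in>K. (\<Sum>i\<in>I. A k i * A l i) * D2 k l s)"
      by simp
    then show ?thesis
      using heat_taylor[OF I K F b D(3,4) t, of A s] heat_taylor[OF I K F b D(3,4) t, of B s]
      unfolding c_def distrib_right abs_le_iff by linarith
  qed
  \<comment> \<open>\<open>j\<close> exchanges: the scale \<open>t * sqrt j\<close> is that of a sum
    of \<open>j\<close> independent copies at scale \<open>t\<close>.\<close>
  have iterate: "heat I A (t * sqrt (real j)) F s \<ge> heat I B (t * sqrt (real j)) F s - real j * (c * t ^ 3)"
    if t: "t > 0" for t j s
  proof (induction j arbitrary: s)
    case 0
    show ?case by (simp add: heat_0)
  next
    case (Suc j)
    let ?u = "t * sqrt (real j)"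
    have "t\<^sup>2 + ?u\<^sup>2 = t\<^sup>2 * real (Suc j)"
      by (simp add: power_mult_distrib algebra_simps)
    then have sqrt_Suc: "sqrt (t\<^sup>2 + ?u\<^sup>2) = t * sqrt (real (Suc j))"
      using t by (simp only: real_sqrt_mult) simp
    have int_const: "integrable (gauss I) (\<lambda>w. heat I X x F (\<lambda>k. s k + y * lin I Y w k) - r)"
      "(\<integral>w. heat I X x F (\<lambda>k. s k + y * lin I Y w k) - r \<partial>gauss I)
        = (\<integral>w. heat I X x F (\<lambda>k. s k + y * lin I Y w k) \<partial>gauss I) - r" for X x y Y r
      by (simp_all add: integrable_heat_shift[OF F b] gauss.P.prob_space)
    \<comment> \<open>One copy of \<open>B\<close> is split off and made innermost, where
      \<open>step\<close> exchanges it pointwise for a copy of \<open>A\<close>. That copy is then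
      made outermost, and the induction hypothesis, at the randomly shifted base point, exchanges
      the remaining \<open>j\<close> copies.\<close>
    have "heat I B (t * sqrt (real (Suc j))) F s - c * t ^ 3 - real j * (c * t ^ 3)
        = (\<integral>w. heat I B ?u F (\<lambda>k. s k + t * lin I B w k) \<partial>gauss I) - c * t ^ 3 - real j * (c * t ^ 3)"
      using heat_semigroup[OF I F b t, of ?u] t by (simp only: sqrt_Suc) simp
    also have "\<dots> = (\<integral>w. heat I B t F (\<lambda>k. s k + ?u * lin I B w k) - c * t ^ 3 \<partial>gauss I) - real j * (c * t ^ 3)"
      by (simp only: int_const(2) heat_commute[OF F b, of I B ?u s t B])
    also have "\<dots> \<le> (\<integral>w. heat I A t F (\<lambda>k. s k + ?u * lin I B w k) \<partial>gauss I) - real j * (c * t ^ 3)"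
      using t by (intro diff_right_mono integral_mono int_const integrable_heat_shift[OF F b] step) auto
    also have "\<dots> = (\<integral>w. heat I B ?u F (\<lambda>k. s k + t * lin I A w k) - real j * (c * t ^ 3) \<partial>gauss I)"
      by (simp only: int_const(2) heat_commute[OF F b, of I B ?u s t A])
    also have "\<dots> \<le> (\<integral>w. heat I A ?u F (\<lambda>k. s k + t * lin I A w k) \<partial>gauss I)"
      by (intro integral_mono int_const integrable_heat_shift[OF F b] Suc.IH)
    also have "\<dots> = heat I A (t * sqrt (real (Suc j))) F s"
      using heat_semigroup[OF I F b t, of ?u] t by (simp only: sqrt_Suc) simp
    finally show ?case by (simp add: algebra_simps)
  qed
  have "heat I A 1 F s \<ge> heat I B 1 F s - c / sqrt (real n)" if "n > 0" for n :: nat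
  proof -
    \<comment> \<open>With \<open>n\<close> exchanges at scale \<open>1 / sqrt n\<close> the
      accumulated error is of order \<open>1 / sqrt n\<close>.\<close>
    have "real n * (c * (1 / sqrt (real n)) ^ 3) = c / sqrt (real n)"
      using that by (simp add: power3_eq_cube field_simps)
    then show ?thesis
      using iterate[of "1 / sqrt (real n)" n s] that by simp
  qed
  then have "\<forall>\<^sub>F n in sequentially. heat I B 1 F s - c / sqrt (real n) \<le> heat I A 1 F s"
    by (intro eventually_sequentiallyI[of 1]) auto
  moreover have "(\<lambda>n. heat I B 1 F s - c / sqrt (real n)) \<longlonglongrightarrow> heat I B 1 F s - 0"
    by (intro tendsto_diff tendsto_const tendsto_divide_0[OF tendsto_const]
        filterlim_at_top_imp_at_infinity filterlim_compose[OF sqrt_at_top] filterlim_real_sequentially)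
  ultimately show ?thesis
    by (intro tendsto_upperbound[of _ "heat I B 1 F s"]) auto
qed

section \<open>Gordon's comparison inequality\<close>

text \<open>A smooth form of the indicator that some \<open>y\<close> has
  \<open>z (x, y) \<ge> c\<close>: the complement of a product of complements of steps. The argument
  of each step is \<open>j * (z (x, y) - c) + sqrt j\<close>, arranged as an affine function of one
  coordinate to suit \<open>bounded_smooth_logistic\<close>.\<close>

definition soft_row :: "nat \<Rightarrow> real \<Rightarrow> 'y set \<Rightarrow> 'x \<Rightarrow> ('x \<times> 'y \<Rightarrow> real) \<Rightarrow> real" where
  "soft_row j c Y x z = 1 - (\<Prod>y\<in>Y. 1 - logistic (real j * z (x, y) + (sqrt (real j) - real j * c)))"

definition soft_minmax :: "nat \<Rightarrow> real \<Rightarrow> 'x set \<Rightarrow> 'y set \<Rightarrow> ('x \<times> 'y \<Rightarrow> real) \<Rightarrow> real" where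
  "soft_minmax j c X Y z = (\<Prod>x\<in>X. soft_row j c Y x z)"

lemma soft_row_bounds: "0 \<le> soft_row j c Y x z" "soft_row j c Y x z \<le> 1"
  using logistic_bounds unfolding soft_row_def
  by (auto intro!: prod_le_1 prod_nonneg simp: less_imp_le)

lemma soft_row_cong:
  "(\<And>y. y \<in> Y \<Longrightarrow> z (x, y) = z' (x, y)) \<Longrightarrow> soft_row j c Y x z = soft_row j c Y x z'"
  unfolding soft_row_def by (auto intro!: prod.cong)

lemma soft_row_mono:
  "(\<And>y. y \<in> Y \<Longrightarrow> z (x, y) \<le> z' (x, y)) \<Longrightarrow> soft_row j c Y x z \<le> soft_row j c Y x z'"
  using logistic_bounds unfolding soft_row_def
  by (intro diff_left_mono prod_mono) (auto intro!: logistic_mono mult_left_mono simp: less_imp_le)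

lemma soft_minmax_bounds: "0 \<le> soft_minmax j c X Y z" "soft_minmax j c X Y z \<le> 1"
  unfolding soft_minmax_def by (auto intro!: prod_le_1 prod_nonneg soft_row_bounds)

lemma bounded_smooth_soft_minmax:
  assumes "finite X" "finite Y"
  shows "bounded_smooth r (X \<times> Y) (soft_minmax j c X Y)"
  unfolding soft_minmax_def soft_row_def using assms
  by (intro bounded_smooth_prod bounded_smooth_one_minus bounded_smooth_logistic) auto

lemma cylindrical_soft_minmax: "cylindrical (X \<times> Y) (soft_minmax j c X Y)"
  unfolding cylindrical_def
proof (intro conjI allI)
  show "soft_minmax j c X Y \<in> borel_measurable (Pi\<^sub>M (X \<times> Y) (\<lambda>_. borel))"
    unfolding soft_minmax_def soft_row_def
    by (intro borel_measurable_prod borel_measurable_diff borel_measurable_const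
        measurable_compose[OF _ borel_measurable_logistic] borel_measurable_add borel_measurable_times
        measurable_component_singleton) auto
  show "soft_minmax j c X Y (restrict z (X \<times> Y)) = soft_minmax j c X Y z" for z
    unfolding soft_minmax_def by (intro prod.cong soft_row_cong) auto
qed

text \<open>Coordinates in distinct rows affect distinct factors of the product. Each factor is
  nondecreasing and all factors are nonnegative.\<close>

lemma supermodular_soft_minmax:
  assumes "finite X" "x \<in> X" "x' \<in> X" "x \<noteq> x'"
  shows "supermodular_in (x, y) (x', y') (soft_minmax j c X Y)"
  unfolding supermodular_in_def
proof (intro allI impI)
  fix z :: "'a \<times> 'b \<Rightarrow> real" and a b :: real assume ab: "0 \<le> a" "0 \<le> b"
  let ?k = "(x, y)" and ?l = "(x', y')"
  define za zb zab where "za = z(?k := z ?k + a)" and "zb = z(?l := z ?l + b)"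
    and "zab = z(?k := z ?k + a, ?l := z ?l + b)"
  note defs = za_def zb_def zab_def
  let ?R = "\<lambda>z. \<Prod>u\<in>X - {x} - {x'}. soft_row j c Y u z"
  have split: "soft_minmax j c X Y w = soft_row j c Y x w * (soft_row j c Y x' w * ?R w)" for w
    unfolding soft_minmax_def using assms by (simp add: prod.remove[of X x] prod.remove[of "X - {x}" x'])
  have R: "?R za = ?R z" "?R zb = ?R z" "?R zab = ?R z"
    by (intro prod.cong refl soft_row_cong; auto simp: defs)+
  have x: "soft_row j c Y x zb = soft_row j c Y x z" "soft_row j c Y x zab = soft_row j c Y x za"
    using \<open>x \<noteq> x'\<close> by (auto intro!: soft_row_cong simp: defs)
  have x': "soft_row j c Y x' za = soft_row j c Y x' z" "soft_row j c Y x' zab = soft_row j c Y x' zb"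
    using \<open>x \<noteq> x'\<close> by (auto intro!: soft_row_cong simp: defs)
  have mono: "soft_row j c Y x z \<le> soft_row j c Y x za" "soft_row j c Y x' z \<le> soft_row j c Y x' zb"
    using ab by (auto intro!: soft_row_mono simp: defs)
  \<comment> \<open>Expanded, this product of two increments and the untouched rows is exactly the
    difference of the two sides of the supermodular inequality.\<close>
  have "0 \<le> (soft_row j c Y x za - soft_row j c Y x z) * (soft_row j c Y x' zb - soft_row j c Y x' z) * ?R z"
    using mono by (intro mult_nonneg_nonneg prod_nonneg) (auto intro: soft_row_bounds)
  then show "soft_minmax j c X Y (z(?k := z ?k + a)) + soft_minmax j c X Y (z(?l := z ?l + b))
      \<le> soft_minmax j c X Y (z(?k := z ?k + a, ?l := z ?l + b)) + soft_minmax j c X Y z"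
    unfolding zab_def[symmetric] unfolding za_def[symmetric] zb_def[symmetric] split R x x' by (simp add: algebra_simps)
qed

text \<open>The shift by \<open>sqrt j\<close> makes the limit equal to 1 also at \<open>u = c\<close>.\<close>

lemma logistic_tendsto_indicator:
  "(\<lambda>j. logistic (real j * u + (sqrt (real j) - real j * c))) \<longlonglongrightarrow> (if c \<le> u then 1 else 0)"
proof -
  have "(\<lambda>j::nat. 1 / (1 + exp (- (real j * d + sqrt (real j))))) \<longlonglongrightarrow> (if 0 \<le> d then 1 else 0)" for d :: real
  proof (cases "d = 0")
    case True
    then show ?thesis by simp real_asymp
  next
    case False
    then consider "d > 0" | "d < 0" by linarith
    then show ?thesis by cases (simp_all, real_asymp+)
  qed
  from this[of "u - c"] show ?thesis
    by (simp add: logistic_def algebra_simps)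
qed

lemma soft_minmax_tendsto_indicator:
  assumes "finite X" "finite Y"
  shows "(\<lambda>j. soft_minmax j c X Y z) \<longlonglongrightarrow> (if \<forall>x\<in>X. \<exists>y\<in>Y. c \<le> z (x, y) then 1 else 0)"
proof -
  have "(\<lambda>j. soft_minmax j c X Y z) \<longlonglongrightarrow> (\<Prod>x\<in>X. 1 - (\<Prod>y\<in>Y. 1 - (if c \<le> z (x, y) then 1 else 0)))"
    unfolding soft_minmax_def soft_row_def
    by (intro tendsto_prod tendsto_diff tendsto_const logistic_tendsto_indicator)
  also have "(\<Prod>x\<in>X. 1 - (\<Prod>y\<in>Y. 1 - (if c \<le> z (x, y) then 1 else 0 :: real)))
      = (\<Prod>x\<in>X. if \<exists>y\<in>Y. c \<le> z (x, y) then 1 else 0)"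
  proof (intro prod.cong refl)
    fix x
    show "1 - (\<Prod>y\<in>Y. 1 - (if c \<le> z (x, y) then 1 else 0 :: real)) = (if \<exists>y\<in>Y. c \<le> z (x, y) then 1 else 0)"
    proof (cases "\<exists>y\<in>Y. c \<le> z (x, y)")
      case True
      then have "(\<Prod>y\<in>Y. 1 - (if c \<le> z (x, y) then 1 else 0 :: real)) = 0"
        using assms by (intro prod_zero) auto
      then show ?thesis using True by simp
    next
      case False
      then have "(\<Prod>y\<in>Y. 1 - (if c \<le> z (x, y) then 1 else 0 :: real)) = 1"
        by (intro prod.neutral) auto
      then show ?thesis using False by simp
    qed
  qed
  also have "\<dots> = (if \<forall>x\<in>X. \<exists>y\<in>Y. c \<le> z (x, y) then 1 else 0)"
  proof (cases "\<forall>x\<in>X. \<exists>y\<in>Y. c \<le> z (x, y)")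
    case True
    then show ?thesis by (auto intro!: prod.neutral)
  next
    case False
    then show ?thesis using assms by (auto simp: prod_zero_iff)
  qed
  finally show ?thesis .
qed

text \<open>The Gaussian comparison is applied to the smooth indicators, and \<open>j\<close> tends
  to infinity under dominated convergence. Within one row the mixed partials of
  \<open>soft_minmax\<close> are nonpositive, hence the equality in \<open>same\<close>; across rows
  supermodularity gives the sign, hence the inequality in \<open>diff\<close>.\<close>

theorem gordon_comparison:
  fixes A B :: "'x \<times> 'y \<Rightarrow> 'i \<Rightarrow> real"
  assumes I: "finite I" and X: "finite X" and Y: "finite Y"
    and same: "\<And>x y y'. x \<in> X \<Longrightarrow> y \<in> Y \<Longrightarrow> y' \<in> Y \<Longrightarrow>
      (\<Sum>i\<in>I. A (x, y) i * A (x, y') i) = (\<Sum>i\<in>I. B (x, y) i * B (x, y') i)"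
    and diff: "\<And>x x' y y'. x \<in> X \<Longrightarrow> x' \<in> X \<Longrightarrow> x \<noteq> x' \<Longrightarrow> y \<in> Y \<Longrightarrow> y' \<in> Y \<Longrightarrow>
      (\<Sum>i\<in>I. A (x, y) i * A (x', y') i) \<ge> (\<Sum>i\<in>I. B (x, y) i * B (x', y') i)"
  shows "measure (gauss I) {w \<in> space (gauss I). \<forall>x\<in>X. \<exists>y\<in>Y. c \<le> lin I B w (x, y)}
    \<le> measure (gauss I) {w \<in> space (gauss I). \<forall>x\<in>X. \<exists>y\<in>Y. c \<le> lin I A w (x, y)}"
proof -
  have lim: "(\<lambda>j. heat I D 1 (soft_minmax j c X Y) (\<lambda>_. 0))
      \<longlonglongrightarrow> measure (gauss I) {w \<in> space (gauss I). \<forall>x\<in>X. \<exists>y\<in>Y. c \<le> lin I D w (x, y)}"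
    for D :: "'x \<times> 'y \<Rightarrow> 'i \<Rightarrow> real"
  proof -
    let ?E = "{w \<in> space (gauss I). \<forall>x\<in>X. \<exists>y\<in>Y. c \<le> lin I D w (x, y)}"
    have [measurable]: "(\<lambda>w. lin I D w k) \<in> borel_measurable (gauss I)" for k
      by (rule measurable_lin) (rule measurable_ident_sets[OF refl])
    have E: "?E \<in> sets (gauss I)"
      using X Y by measurable
    have "(\<lambda>j. \<integral>w. soft_minmax j c X Y (\<lambda>k. 0 + 1 * lin I D w k) \<partial>gauss I)
        \<longlonglongrightarrow> (\<integral>w. indicator ?E w \<partial>gauss I)"
    proof (rule integral_dominated_convergence[where w="\<lambda>_. 1"])
      show "(\<lambda>w. soft_minmax j c X Y (\<lambda>k. 0 + 1 * lin I D w k)) \<in> borel_measurable (gauss I)" for j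
        by (rule cylindrical_measurable[OF cylindrical_soft_minmax]) measurable
      show "AE w in gauss I. (\<lambda>j. soft_minmax j c X Y (\<lambda>k. 0 + 1 * lin I D w k)) \<longlonglongrightarrow> indicator ?E w"
        using soft_minmax_tendsto_indicator[OF X Y, of c "lin I D w" for w]
        by (auto intro!: AE_I2 simp: indicator_def of_bool_def)
      show "AE w in gauss I. norm (soft_minmax j c X Y (\<lambda>k. 0 + 1 * lin I D w k)) \<le> 1" for j
        by (intro AE_I2) (simp add: abs_of_nonneg soft_minmax_bounds)
    qed (use E in auto)
    then show ?thesis using E by (simp add: heat_def)
  qed
  have "heat I B 1 (soft_minmax j c X Y) (\<lambda>_. 0) \<le> heat I A 1 (soft_minmax j c X Y) (\<lambda>_. 0)" for j
  proof (rule gaussian_comparison[OF I _ cylindrical_soft_minmax])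
    fix k l assume kl: "k \<in> X \<times> Y" "l \<in> X \<times> Y"
    then obtain x y x' y' where "k = (x, y)" "l = (x', y')" "x \<in> X" "y \<in> Y" "x' \<in> X" "y' \<in> Y"
      by auto
    then show "(\<Sum>i\<in>I. A k i * A l i) = (\<Sum>i\<in>I. B k i * B l i)
      \<or> (\<Sum>i\<in>I. A k i * A l i) \<ge> (\<Sum>i\<in>I. B k i * B l i) \<and> k \<noteq> l
         \<and> supermodular_in k l (soft_minmax j c X Y)"
      using same diff by (cases "x = x'") (auto intro!: supermodular_soft_minmax X)
  qed (use X Y bounded_smooth_soft_minmax in auto)
  then show ?thesis
    by (intro LIMSEQ_le[OF lim lim]) auto
qed

section \<open>The minmax value of a Gaussian matrix\<close>

lemma (in prob_space) nn_integral_mono_of_tail: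
  fixes X Y :: "'a \<Rightarrow> real"
  assumes [measurable]: "X \<in> borel_measurable M" "Y \<in> borel_measurable M"
    and tail: "\<And>t. t > 0 \<Longrightarrow> prob {w \<in> space M. t \<le> Y w} \<le> prob {w \<in> space M. t \<le> X w}"
  shows "(\<integral>\<^sup>+w. ennreal (Y w) \<partial>M) \<le> (\<integral>\<^sup>+w. ennreal (X w) \<partial>M)"
proof -
  interpret pair_sigma_finite M lborel ..
  \<comment> \<open>The layer-cake formula. Since \<open>ennreal\<close> sends negative reals to 0,
    the left side is the expectation of the positive part.\<close>
  have layer: "(\<integral>\<^sup>+w. ennreal (Z w) \<partial>M)
      = (\<integral>\<^sup>+t. indicator {0<..} t * ennreal (prob {w \<in> space M. t \<le> Z w}) \<partial>lborel)"
    if [measurable]: "Z \<in> borel_measurable M" for Z :: "'a \<Rightarrow> real"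
  proof -
    have "(\<integral>\<^sup>+w. ennreal (Z w) \<partial>M) = (\<integral>\<^sup>+w. \<integral>\<^sup>+t. indicator {t. 0 < t \<and> t \<le> Z w} t \<partial>lborel \<partial>M)"
    proof (intro nn_integral_cong)
      fix w
      have "{t. 0 < t \<and> t \<le> Z w} = {0<..Z w}" by auto
      then show "ennreal (Z w) = (\<integral>\<^sup>+t. indicator {t. 0 < t \<and> t \<le> Z w} t \<partial>lborel)"
        by (cases "0 \<le> Z w") (auto simp: ennreal_neg)
    qed
    also have "\<dots> = (\<integral>\<^sup>+t. \<integral>\<^sup>+w. indicator {t. 0 < t \<and> t \<le> Z w} t \<partial>M \<partial>lborel)"
      by (rule Fubini'[symmetric]) (simp add: indicator_def case_prod_beta')
    also have "\<dots> = (\<integral>\<^sup>+t. indicator {0<..} t * ennreal (prob {w \<in> space M. t \<le> Z w}) \<partial>lborel)"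
    proof (intro nn_integral_cong)
      fix t
      have "(\<integral>\<^sup>+w. indicator {t. 0 < t \<and> t \<le> Z w} t \<partial>M)
          = (\<integral>\<^sup>+w. indicator {0<..} t * indicator {w \<in> space M. t \<le> Z w} w \<partial>M)"
        by (intro nn_integral_cong) (auto simp: indicator_def)
      also have "\<dots> = indicator {0<..} t * ennreal (prob {w \<in> space M. t \<le> Z w})"
        by (subst nn_integral_cmult) (auto simp: emeasure_eq_measure)
      finally show "(\<integral>\<^sup>+w. indicator {t. 0 < t \<and> t \<le> Z w} t \<partial>M)
          = indicator {0<..} t * ennreal (prob {w \<in> space M. t \<le> Z w})" .
    qed
    finally show ?thesis .
  qed
  show ?thesis
    unfolding layer[OF assms(1)] layer[OF assms(2)]
    by (intro nn_integral_mono) (auto simp: indicator_def intro!: ennreal_leI tail)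
qed

text \<open>Positive and negative parts are compared separately. The tail of \<open>- Z\<close> at
  \<open>t\<close> is the complement of a strict tail of \<open>Z\<close> at \<open>- t\<close>, so
  the hypothesis is first carried over to strict tails by approximation from above.\<close>

lemma (in prob_space) expectation_mono_of_tail:
  fixes X Y :: "'a \<Rightarrow> real"
  assumes X: "integrable M X" and Y: "integrable M Y"
    and tail: "\<And>t. prob {w \<in> space M. t \<le> Y w} \<le> prob {w \<in> space M. t \<le> X w}"
  shows "expectation Y \<le> expectation X"
proof -
  have [measurable]: "X \<in> borel_measurable M" "Y \<in> borel_measurable M"
    using X Y by auto
  have lim: "(\<lambda>n. prob {w \<in> space M. t + inverse (real (Suc n)) \<le> Z w}) \<longlonglongrightarrow> prob {w \<in> space M. t < Z w}"
    if [measurable]: "Z \<in> borel_measurable M" for Z t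
  proof -
    have "\<exists>n. t + inverse (real (Suc n)) \<le> Z w" if "t < Z w" for w
      using reals_Archimedean[of "Z w - t"] that by (auto simp: algebra_simps intro: less_imp_le)
    moreover have "t < Z w" if "t + inverse (real (Suc n)) \<le> Z w" for n w
      using that inverse_positive_iff_positive[of "real (Suc n)"] by linarith
    ultimately have "{w \<in> space M. t < Z w} = (\<Union>n. {w \<in> space M. t + inverse (real (Suc n)) \<le> Z w})"
      by blast
    moreover have "incseq (\<lambda>n. {w \<in> space M. t + inverse (real (Suc n)) \<le> Z w})"
    proof (intro incseq_SucI subsetI CollectI conjI)
      fix n w
      assume w: "w \<in> {w \<in> space M. t + inverse (real (Suc n)) \<le> Z w}"
      have "t + inverse (real (Suc (Suc n))) \<le> t + inverse (real (Suc n))"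
        by (intro add_left_mono le_imp_inverse_le) auto
      also have "\<dots> \<le> Z w" using w by blast
      finally show "t + inverse (real (Suc (Suc n))) \<le> Z w" .
    qed simp
    ultimately show ?thesis
      by (simp only:) (rule finite_Lim_measure_incseq, auto)
  qed
  have strict: "prob {w \<in> space M. t < Y w} \<le> prob {w \<in> space M. t < X w}" for t
    by (rule LIMSEQ_le[OF lim lim]) (use tail in auto)
  have "(\<integral>\<^sup>+w. ennreal (- X w) \<partial>M) \<le> (\<integral>\<^sup>+w. ennreal (- Y w) \<partial>M)"
  proof (rule nn_integral_mono_of_tail)
    fix t :: real
    have "prob {w \<in> space M. t \<le> - Z w} = 1 - prob {w \<in> space M. - t < Z w}"
      if [measurable]: "Z \<in> borel_measurable M" for Z
    proof -
      have "{w \<in> space M. t \<le> - Z w} = space M - {w \<in> space M. - t < Z w}" by auto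
      then show ?thesis by (simp add: prob_compl)
    qed
    then show "prob {w \<in> space M. t \<le> - X w} \<le> prob {w \<in> space M. t \<le> - Y w}"
      using strict by simp
  qed auto
  moreover have "(\<integral>\<^sup>+w. ennreal (Y w) \<partial>M) \<le> (\<integral>\<^sup>+w. ennreal (X w) \<partial>M)"
    by (rule nn_integral_mono_of_tail) (auto intro: tail)
  ultimately show ?thesis
    using X Y by (auto simp: real_lebesgue_integral_def real_integrable_def less_top
        intro!: diff_mono enn2real_mono)
qed


text \<open>
  All Gaussians are stored in one \<open>(m + 1) \<times> (n + 1)\<close> array: \<open>H\<close> in the entries \<open>(i, j)\<close> with
  \<open>i < m\<close> and \<open>j < n\<close>, the vector \<open>g\<close> in column \<open>n\<close>, the vector \<open>h\<close> in row \<open>m\<close>, and the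
  scalar \<open>\<gamma>\<close> in the corner \<open>(m, n)\<close>.
\<close>

definition corner_index :: "nat \<Rightarrow> nat \<Rightarrow> (nat \<times> nat) set" where
  "corner_index m n = {..m} \<times> {..n}"

lemma finite_corner_index [simp]: "finite (corner_index m n)"
  by (simp add: corner_index_def)

lemma sum_corner_index:
  fixes f :: "nat \<times> nat \<Rightarrow> real"
  shows "sum f (corner_index m n)
    = (\<Sum>i<m. \<Sum>j<n. f (i, j)) + (\<Sum>i<m. f (i, n)) + (\<Sum>j<n. f (m, j)) + f (m, n)"
proof -
  have "sum f (corner_index m n) = (\<Sum>i<Suc m. \<Sum>j<Suc n. f (i, j))"
    by (simp only: corner_index_def lessThan_Suc_atMost sum.cartesian_product) simp
  then show ?thesis by (simp add: sum.distrib)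
qed

section \<open>The two processes and their covariances\<close>

definition coef_X :: "nat \<Rightarrow> nat \<Rightarrow> (nat \<Rightarrow> real) \<times> (nat \<Rightarrow> real) \<Rightarrow> nat \<times> nat \<Rightarrow> real" where
  "coef_X m n = (\<lambda>(x, y) (i, j). if i < m \<and> j < n then y i * x j else if i = m \<and> j = n then 1 else 0)"

definition coef_Y :: "nat \<Rightarrow> nat \<Rightarrow> (nat \<Rightarrow> real) \<times> (nat \<Rightarrow> real) \<Rightarrow> nat \<times> nat \<Rightarrow> real" where
  "coef_Y m n = (\<lambda>(x, y) (i, j). if i < m \<and> j = n then y i else if i = m \<and> j < n then x j else 0)"

text \<open>The summand 1 comes from the corner scalar. On unit vectors it brings the variance to 2,
  that of the other process, and it makes the difference of the two covariances factor.\<close>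

lemma covariance_X:
  "(\<Sum>i\<in>corner_index m n. coef_X m n (x, y) i * coef_X m n (x', y') i)
    = (\<Sum>j<n. x j * x' j) * (\<Sum>i<m. y i * y' i) + 1"
  by (simp add: sum_corner_index coef_X_def sum_product mult_ac)
     (simp add: sum.swap[of _ "{..<m}"])

lemma covariance_Y:
  "(\<Sum>i\<in>corner_index m n. coef_Y m n (x, y) i * coef_Y m n (x', y') i)
    = (\<Sum>j<n. x j * x' j) + (\<Sum>i<m. y i * y' i)"
  by (simp add: sum_corner_index coef_Y_def)

lemma lin_X:
  "lin (corner_index m n) (coef_X m n) w (x, y) = bilin m n (\<lambda>i j. w (i, j)) y x + w (m, n)"
  by (simp add: lin_def sum_corner_index coef_X_def bilin_def mult_ac)

lemma lin_Y:
  "lin (corner_index m n) (coef_Y m n) w (x, y) = (\<Sum>i<m. y i * w (i, n)) + (\<Sum>j<n. x j * w (m, j))"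
  by (simp add: lin_def sum_corner_index coef_Y_def)

lemma finite_normalized_cube [simp]: "finite (normalized_cube n)"
  unfolding normalized_cube_def by (intro finite_PiE) auto

lemma normalized_cube_nonempty [simp]: "normalized_cube n \<noteq> {}"
  unfolding normalized_cube_def by (auto simp: PiE_eq_empty_iff)

lemma normalized_cube_abs:
  assumes "x \<in> normalized_cube n" "j < n"
  shows "\<bar>x j\<bar> = 1 / sqrt (real n)"
proof -
  have "x j \<in> {- 1 / sqrt (real n), 1 / sqrt (real n)}"
    using assms by (intro PiE_mem[of x "{..<n}"]) (auto simp: normalized_cube_def)
  then show ?thesis by auto
qed

lemma normalized_cube_sq:
  assumes "x \<in> normalized_cube n" "j < n"
  shows "x j * x j = 1 / real n"
proof -
  have "x j * x j = \<bar>x j\<bar> * \<bar>x j\<bar>" by (simp only: abs_mult_self_eq)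
  also have "\<dots> = (1 / sqrt (real n)) * (1 / sqrt (real n))"
    by (simp only: normalized_cube_abs[OF assms])
  finally show ?thesis by simp
qed

lemma normalized_cube_norm: "x \<in> normalized_cube n \<Longrightarrow> n > 0 \<Longrightarrow> (\<Sum>j<n. x j * x j) = 1"
  by (simp add: normalized_cube_sq)

lemma normalized_cube_inner_le:
  assumes "x \<in> normalized_cube n" "x' \<in> normalized_cube n" "n > 0"
  shows "(\<Sum>j<n. x j * x' j) \<le> 1"
proof -
  have "(\<Sum>j<n. x j * x' j) \<le> (\<Sum>j<n. 1 / real n)"
  proof (rule sum_mono)
    fix j assume "j \<in> {..<n}"
    then have "\<bar>x j * x' j\<bar> = 1 / real n"
      using assms by (simp add: abs_mult normalized_cube_abs)
    then show "x j * x' j \<le> 1 / real n" by linarith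
  qed
  then show ?thesis using assms by simp
qed

text \<open>Brings the tail event of the minmax value into the quantifier form of Gordon's
  inequality.\<close>

lemma minmax_value_ge_iff:
  "c \<le> minmax_value m n A \<longleftrightarrow> (\<forall>x\<in>normalized_cube n. \<exists>y\<in>normalized_cube m. c \<le> bilin m n A y x)"
  unfolding minmax_value_def by (subst Min_ge_iff) (auto simp: Max_ge_iff)

abbreviation corner_minmax :: "nat \<Rightarrow> nat \<Rightarrow> (nat \<times> nat \<Rightarrow> real) \<Rightarrow> real" where
  "corner_minmax m n w \<equiv> minmax_value m n (\<lambda>i j. w (i, j))"

text \<open>The minmax of the decoupled process: the signs of \<open>y\<close> follow column
  \<open>n\<close>, which contributes a scaled l1 norm, and the signs of \<open>x\<close> oppose row
  \<open>m\<close>, which subtracts one.\<close>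

definition decoupled :: "nat \<Rightarrow> nat \<Rightarrow> (nat \<times> nat \<Rightarrow> real) \<Rightarrow> real" where
  "decoupled m n w = (\<Sum>i<m. \<bar>w (i, n)\<bar>) / sqrt (real m) - (\<Sum>j<n. \<bar>w (m, j)\<bar>) / sqrt (real n)"

lemma decoupled_le_minmax:
  assumes x: "x \<in> normalized_cube n"
  shows "\<exists>y\<in>normalized_cube m. decoupled m n w \<le> lin (corner_index m n) (coef_Y m n) w (x, y)"
proof
  \<comment> \<open>The sign vector of column \<open>n\<close> maximises the part depending on
    \<open>y\<close>, whatever \<open>x\<close> is; \<open>restrict\<close> makes it extensional, as
    membership in the cube demands.\<close>
  let ?y = "\<lambda>i\<in>{..<m}. if 0 \<le> w (i, n) then 1 / sqrt (real m) else - 1 / sqrt (real m)"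
  show "?y \<in> normalized_cube m"
    unfolding normalized_cube_def by auto
  have "(\<Sum>i<m. ?y i * w (i, n)) = (\<Sum>i<m. \<bar>w (i, n)\<bar>) / sqrt (real m)"
    unfolding sum_divide_distrib by (intro sum.cong) auto
  moreover have "(\<Sum>j<n. - (\<bar>w (m, j)\<bar> / sqrt (real n))) \<le> (\<Sum>j<n. x j * w (m, j))"
  proof (rule sum_mono)
    fix j assume "j \<in> {..<n}"
    then have "\<bar>x j * w (m, j)\<bar> = \<bar>w (m, j)\<bar> / sqrt (real n)"
      using x by (simp add: abs_mult normalized_cube_abs)
    then show "- (\<bar>w (m, j)\<bar> / sqrt (real n)) \<le> x j * w (m, j)" by linarith
  qed
  ultimately show "decoupled m n w \<le> lin (corner_index m n) (coef_Y m n) w (x, ?y)"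
    by (simp add: decoupled_def lin_Y sum_negf sum_divide_distrib)
qed

lemma measurable_corner [measurable]:
  "i \<le> m \<Longrightarrow> j \<le> n \<Longrightarrow> (\<lambda>w. w (i, j)) \<in> borel_measurable (gauss (corner_index m n))"
  by (rule measurable_gauss_component) (simp add: corner_index_def)

lemma measurable_corner_minmax [measurable]:
  "corner_minmax m n \<in> borel_measurable (gauss (corner_index m n))"
  unfolding minmax_value_def bilin_def by measurable

lemma measurable_decoupled [measurable]:
  "decoupled m n \<in> borel_measurable (gauss (corner_index m n))"
  unfolding decoupled_def[abs_def] by measurable

lemma minmax_dominates_decoupled:
  assumes "m > 0" "n > 0"
  defines "G \<equiv> gauss (corner_index m n)"
  shows "measure G {w \<in> space G. c \<le> decoupled m n w}
    \<le> measure G {w \<in> space G. c \<le> corner_minmax m n w + w (m, n)}"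
proof -
  let ?lin = "lin (corner_index m n)" and ?X = "normalized_cube n" and ?Y = "normalized_cube m"
  have [measurable]: "(\<lambda>w. ?lin D w k) \<in> borel_measurable G" for D k
    unfolding G_def by (rule measurable_lin) (rule measurable_ident_sets[OF refl])
  have "measure G {w \<in> space G. c \<le> decoupled m n w}
      \<le> measure G {w \<in> space G. \<forall>x\<in>?X. \<exists>y\<in>?Y. c \<le> ?lin (coef_Y m n) w (x, y)}"
    unfolding G_def
  proof (rule gauss.P.finite_measure_mono)
    show "{w \<in> space (gauss (corner_index m n)). c \<le> decoupled m n w}
        \<subseteq> {w \<in> space (gauss (corner_index m n)). \<forall>x\<in>?X. \<exists>y\<in>?Y. c \<le> ?lin (coef_Y m n) w (x, y)}"
      using decoupled_le_minmax by (blast intro: order_trans)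
  qed (unfold G_def[symmetric], measurable)
  also have "\<dots> \<le> measure G {w \<in> space G. \<forall>x\<in>?X. \<exists>y\<in>?Y. c \<le> ?lin (coef_X m n) w (x, y)}"
    unfolding G_def
  proof (rule gordon_comparison)
    fix x y y' assume "x \<in> ?X" "y \<in> ?Y" "y' \<in> ?Y"
    then show "(\<Sum>i\<in>corner_index m n. coef_X m n (x, y) i * coef_X m n (x, y') i)
        = (\<Sum>i\<in>corner_index m n. coef_Y m n (x, y) i * coef_Y m n (x, y') i)"
      using assms by (simp add: covariance_X covariance_Y normalized_cube_norm)
  next
    fix x x' y y' assume "x \<in> ?X" "x' \<in> ?X" "x \<noteq> x'" "y \<in> ?Y" "y' \<in> ?Y"
    \<comment> \<open>This product is the covariance of \<open>X\<close> minus that of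
      \<open>Y\<close>; each factor is nonnegative because inner products on the cube are at most
      1.\<close>
    then have "0 \<le> (1 - (\<Sum>j<n. x j * x' j)) * (1 - (\<Sum>i<m. y i * y' i))"
      using assms by (intro mult_nonneg_nonneg) (auto intro: normalized_cube_inner_le)
    then show "(\<Sum>i\<in>corner_index m n. coef_Y m n (x, y) i * coef_Y m n (x', y') i)
        \<le> (\<Sum>i\<in>corner_index m n. coef_X m n (x, y) i * coef_X m n (x', y') i)"
      by (simp add: covariance_X covariance_Y algebra_simps)
  qed auto
  also have "{w \<in> space G. \<forall>x\<in>?X. \<exists>y\<in>?Y. c \<le> ?lin (coef_X m n) w (x, y)}
      = {w \<in> space G. c \<le> corner_minmax m n w + w (m, n)}"
    using minmax_value_ge_iff[of "c - w (m, n)" m n "\<lambda>i j. w (i, j)" for w]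
    by (auto simp: lin_X algebra_simps)
  finally show ?thesis .
qed

text \<open>After centering, the decoupled variable is a weighted sum of independent copies of the
  centred absolute value \<open>f\<close> of a standard normal. The variance of \<open>f\<close> is
  at most 1 and the squared weights add up to \<open>m * (1 / m) + n * (1 / n) = 2\<close>.\<close>

lemma decoupled_moments:
  assumes "m > 0" "n > 0"
  defines "G \<equiv> gauss (corner_index m n)" and "\<mu> \<equiv> sqrt (2 / pi) * (sqrt (real m) - sqrt (real n))"
  shows "integrable G (decoupled m n)" "(\<integral>w. decoupled m n w \<partial>G) = \<mu>"
    "integrable G (\<lambda>w. (decoupled m n w - \<mu>)\<^sup>2)" "(\<integral>w. (decoupled m n w - \<mu>)\<^sup>2 \<partial>G) \<le> 2"
proof -
  define s where "s = sqrt (2 / pi)"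
  define f where "f x = \<bar>x\<bar> - s" for x
  define c where "c = (\<lambda>(i, j). if i < m \<and> j = n then 1 / sqrt (real m)
    else if i = m \<and> j < n then - 1 / sqrt (real n) else 0)"
  have abs1: "integrable std_gauss (\<lambda>x. \<bar>x\<bar>)"
    using integrable_std_gauss_abs_power[of 1] by simp
  have f1: "integrable std_gauss f" "(\<integral>x. f x \<partial>std_gauss) = 0"
    using abs1 by (simp_all add: f_def[abs_def] std_gauss_moments std_gauss.prob_space[simplified] s_def)
  have f_sq: "(f x)\<^sup>2 = x\<^sup>2 - 2 * s * \<bar>x\<bar> + s\<^sup>2" for x
    by (simp add: f_def power2_diff)
  have f2: "integrable std_gauss (\<lambda>x. (f x)\<^sup>2)"
    using abs1 std_gauss_moments(1)[of 2] by (simp add: f_sq)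
  have "(\<integral>x. (f x)\<^sup>2 \<partial>std_gauss) = 1 - 2 * s * s + s\<^sup>2"
    using abs1 std_gauss_moments(1)[of 2] unfolding f_sq
    by (simp add: std_gauss_moments std_gauss.prob_space[simplified] s_def)
  then have var: "(\<integral>x. (f x)\<^sup>2 \<partial>std_gauss) \<le> 1"
    by (simp add: power2_eq_square)
  have dec: "decoupled m n w - \<mu> = (\<Sum>k\<in>corner_index m n. c k * f (w k))" for w
  proof -
    have "(\<Sum>k\<in>corner_index m n. c k * f (w k))
        = (\<Sum>i<m. f (w (i, n))) / sqrt (real m) - (\<Sum>j<n. f (w (m, j))) / sqrt (real n)"
      by (simp add: sum_corner_index c_def sum_divide_distrib sum_negf)
    also have "\<dots> = decoupled m n w - s * (real m / sqrt (real m) - real n / sqrt (real n))"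
      by (simp add: f_def decoupled_def sum_subtractf diff_divide_distrib algebra_simps)
    finally show ?thesis
      by (simp add: \<mu>_def s_def real_div_sqrt)
  qed
  have c2: "(\<Sum>k\<in>corner_index m n. c k * c k) = 2"
    using assms by (simp add: sum_corner_index c_def)
  note mom = gauss_linear_moments[OF finite_corner_index f1(1) f2 f1(2), of m n]
  have int: "integrable G (\<lambda>w. decoupled m n w - \<mu>)"
    unfolding dec G_def by (rule mom(1))
  have "integrable G (\<lambda>w. (decoupled m n w - \<mu>) + \<mu>)"
    by (intro Bochner_Integration.integrable_add int) (simp add: G_def)
  then show "integrable G (decoupled m n)" by simp
  have "(\<integral>w. (decoupled m n w - \<mu>) + \<mu> \<partial>G) = (\<integral>w. decoupled m n w - \<mu> \<partial>G) + \<mu>"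
    using int by (subst Bochner_Integration.integral_add) (simp_all add: G_def gauss.P.prob_space)
  also have "(\<integral>w. decoupled m n w - \<mu> \<partial>G) = 0"
    unfolding dec G_def by (rule mom(2))
  finally show "(\<integral>w. decoupled m n w \<partial>G) = \<mu>" by simp
  show "integrable G (\<lambda>w. (decoupled m n w - \<mu>)\<^sup>2)"
    unfolding dec G_def power2_eq_square by (rule mom(3))
  have "(\<integral>w. (decoupled m n w - \<mu>)\<^sup>2 \<partial>G) = 2 * (\<integral>x. (f x)\<^sup>2 \<partial>std_gauss)"
    unfolding dec G_def power2_eq_square[of "\<Sum>k\<in>_. _ k"] mom(4) c2 ..
  then show "(\<integral>w. (decoupled m n w - \<mu>)\<^sup>2 \<partial>G) \<le> 2"
    using var by simp
qed

section \<open>Mean and lower tail of the minmax value\<close>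

lemma minmax_value_attained:
  "\<exists>x\<in>normalized_cube n. \<exists>y\<in>normalized_cube m. minmax_value m n A = bilin m n A y x"
proof -
  let ?M = "\<lambda>x. MAX y\<in>normalized_cube m. bilin m n A y x"
  have "Min (?M ` normalized_cube n) \<in> ?M ` normalized_cube n"
    by (intro Min_in) auto
  then obtain x where "x \<in> normalized_cube n" "Min (?M ` normalized_cube n) = ?M x"
    by (rule imageE)
  then have x: "x \<in> normalized_cube n" "minmax_value m n A = ?M x"
    by (simp_all only: minmax_value_def)
  have "?M x \<in> (\<lambda>y. bilin m n A y x) ` normalized_cube m"
    by (intro Max_in) auto
  then obtain y where "y \<in> normalized_cube m" "?M x = bilin m n A y x"
    by (rule imageE)
  with x show ?thesis by metis
qed

lemma normalized_cube_abs_le_one: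
  assumes "x \<in> normalized_cube n" "j < n"
  shows "\<bar>x j\<bar> \<le> 1"
  using assms by (simp add: normalized_cube_abs)

text \<open>The minmax is attained at some pair of sign vectors, whose entries are at most 1 in
  absolute value, so it is dominated by the sum of the absolute values of all entries.\<close>

lemma integrable_corner_minmax: "integrable (gauss (corner_index m n)) (corner_minmax m n)"
proof (rule Bochner_Integration.integrable_bound)
  show "integrable (gauss (corner_index m n)) (\<lambda>w. \<Sum>k\<in>corner_index m n. \<bar>w k\<bar>)"
    using integrable_std_gauss_abs_power[of 1]
    by (intro Bochner_Integration.integrable_sum gauss_component_integral(1)) auto
  show "AE w in gauss (corner_index m n).
      norm (corner_minmax m n w) \<le> norm (\<Sum>k\<in>corner_index m n. \<bar>w k\<bar>)"
  proof (rule AE_I2)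
    fix w
    obtain x y where xy: "x \<in> normalized_cube n" "y \<in> normalized_cube m"
      "corner_minmax m n w = bilin m n (\<lambda>i j. w (i, j)) y x"
      using minmax_value_attained by blast
    have "\<bar>corner_minmax m n w\<bar> \<le> (\<Sum>i<m. \<Sum>j<n. \<bar>w (i, j)\<bar>)"
      unfolding xy(3) bilin_def
    proof (intro order_trans[OF sum_abs] sum_mono)
      fix i j assume ij: "i \<in> {..<m}" "j \<in> {..<n}"
      have "\<bar>y i * w (i, j) * x j\<bar> \<le> 1 * \<bar>w (i, j)\<bar> * 1"
        unfolding abs_mult using xy ij
        by (intro mult_mono normalized_cube_abs_le_one) auto
      then show "\<bar>y i * w (i, j) * x j\<bar> \<le> \<bar>w (i, j)\<bar>" by simp
    qed
    also have "\<dots> \<le> (\<Sum>k\<in>corner_index m n. \<bar>w k\<bar>)"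
      unfolding sum_corner_index by (simp add: sum_nonneg)
    finally show "norm (corner_minmax m n w) \<le> norm (\<Sum>k\<in>corner_index m n. \<bar>w k\<bar>)"
      by (simp add: sum_nonneg abs_of_nonneg)
  qed
qed measurable

lemma corner_moments:
  fixes m n :: nat
  defines "G \<equiv> gauss (corner_index m n)"
  shows "integrable G (\<lambda>w. w (m, n))" "(\<integral>w. w (m, n) \<partial>G) = 0"
    "integrable G (\<lambda>w. (w (m, n))\<^sup>2)" "(\<integral>w. (w (m, n))\<^sup>2 \<partial>G) = 1"
proof -
  have k: "(m, n) \<in> corner_index m n" by (simp add: corner_index_def)
  show "integrable G (\<lambda>w. w (m, n))" "(\<integral>w. w (m, n) \<partial>G) = 0"
    "integrable G (\<lambda>w. (w (m, n))\<^sup>2)" "(\<integral>w. (w (m, n))\<^sup>2 \<partial>G) = 1"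
    using gauss_component_integral[OF k, of "\<lambda>x. x"] gauss_component_integral[OF k, of "\<lambda>x. x\<^sup>2"]
      std_gauss_moments(1)[of 1] std_gauss_moments(1)[of 2] std_gauss_moments(2,3)
    by (simp_all add: G_def)
qed

text \<open>The added corner scalar is centred and disappears from the expectation.\<close>

lemma corner_minmax_expectation_ge:
  assumes "m > 0" "n > 0"
  shows "sqrt (2 / pi) * (sqrt (real m) - sqrt (real n))
    \<le> (\<integral>w. corner_minmax m n w \<partial>gauss (corner_index m n))"
proof -
  let ?G = "gauss (corner_index m n)"
  have "(\<integral>w. decoupled m n w \<partial>?G) \<le> (\<integral>w. corner_minmax m n w + w (m, n) \<partial>?G)"
    by (intro gauss.P.expectation_mono_of_tail minmax_dominates_decoupled decoupled_moments
        Bochner_Integration.integrable_add integrable_corner_minmax corner_moments assms)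
  then show ?thesis
    using assms by (simp add: decoupled_moments integrable_corner_minmax corner_moments)
qed

text \<open>The margin \<open>2 * \<eta>\<close> is spent in two halves. If the minmax is below
  \<open>c\<close>, then either the corner scalar is at least \<open>\<eta>\<close> in absolute
  value or the sum of both is below \<open>c + \<eta>\<close>. Chebyshev bounds the first event with
  variance 1 and, via Gordon, the second with variance at most 2.\<close>

lemma corner_minmax_tail:
  assumes mn: "m > 0" "n > 0" and e: "\<eta> > 0"
    and c: "c + 2 * \<eta> \<le> sqrt (2 / pi) * (sqrt (real m) - sqrt (real n))"
  defines "G \<equiv> gauss (corner_index m n)"
  shows "measure G {w \<in> space G. corner_minmax m n w < c} \<le> 3 / \<eta>\<^sup>2"
proof -
  interpret prob_space G unfolding G_def by (rule prob_space_gauss)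
  define \<mu> where "\<mu> = sqrt (2 / pi) * (sqrt (real m) - sqrt (real n))"
  have [measurable]: "corner_minmax m n \<in> borel_measurable G" "decoupled m n \<in> borel_measurable G"
    "(\<lambda>w. w (m, n)) \<in> borel_measurable G"
    unfolding G_def by measurable
  have lt: "prob {w \<in> space G. Z w < t} = 1 - prob {w \<in> space G. t \<le> Z w}"
    if [measurable]: "Z \<in> borel_measurable G" for Z :: "(nat \<times> nat \<Rightarrow> real) \<Rightarrow> real" and t
  proof -
    have "{w \<in> space G. Z w < t} = space G - {w \<in> space G. t \<le> Z w}" by auto
    then show ?thesis by (simp add: prob_compl)
  qed
  have "prob {w \<in> space G. corner_minmax m n w < c}
      \<le> prob ({w \<in> space G. corner_minmax m n w + w (m, n) < c + \<eta>} \<union> {w \<in> space G. \<eta> \<le> \<bar>w (m, n)\<bar>})"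
    by (rule finite_measure_mono) auto
  also have "\<dots> \<le> prob {w \<in> space G. corner_minmax m n w + w (m, n) < c + \<eta>}
      + prob {w \<in> space G. \<eta> \<le> \<bar>w (m, n)\<bar>}"
    by (rule measure_Un_le) auto
  also have "prob {w \<in> space G. \<eta> \<le> \<bar>w (m, n)\<bar>} \<le> 1 / \<eta>\<^sup>2"
    using second_moment_method[of "\<lambda>w. w (m, n)" \<eta>] e corner_moments[of m n] by (simp add: G_def)
  also have "prob {w \<in> space G. corner_minmax m n w + w (m, n) < c + \<eta>}
      \<le> prob {w \<in> space G. decoupled m n w < c + \<eta>}"
    using minmax_dominates_decoupled[OF mn, of "c + \<eta>"] by (simp add: lt G_def[symmetric])
  also have "\<dots> \<le> prob {w \<in> space G. \<eta> \<le> \<bar>decoupled m n w - \<mu>\<bar>}"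
    using c by (intro finite_measure_mono) (auto simp: \<mu>_def)
  also have "\<dots> \<le> 2 / \<eta>\<^sup>2"
  proof (rule order_trans[OF second_moment_method])
    show "expectation (\<lambda>w. (decoupled m n w - \<mu>)\<^sup>2) / \<eta>\<^sup>2 \<le> 2 / \<eta>\<^sup>2"
      unfolding \<mu>_def G_def by (intro divide_right_mono decoupled_moments mn) simp
  qed (use e decoupled_moments(3)[OF mn] in \<open>auto simp: \<mu>_def G_def\<close>)
  finally show ?thesis by (simp add: add_divide_distrib[symmetric])
qed

section \<open>Transfer to the given random matrices\<close>

lemma minmax_value_cong:
  "(\<And>i j. i < m \<Longrightarrow> j < n \<Longrightarrow> A i j = B i j) \<Longrightarrow> minmax_value m n A = minmax_value m n B"
  unfolding minmax_value_def bilin_def by simp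

text \<open>The minmax value reads only the entries indexed by \<open>J\<close>, and there the given
  matrix and the corner array both have law \<open>gauss J\<close>.\<close>

lemma std_normal_matrix_minmax_distr:
  assumes "prob_space M" and H: "std_normal_matrix M m n H" and mn: "m > 0" "n > 0"
  shows "(\<lambda>\<omega>. minmax_value m n (H \<omega>)) \<in> borel_measurable M"
    "distr M borel (\<lambda>\<omega>. minmax_value m n (H \<omega>))
      = distr (gauss (corner_index m n)) borel (corner_minmax m n)"
proof -
  interpret prob_space M by fact
  define J where "J = {..<m} \<times> {..<n}"
  \<comment> \<open>The characterisation of independence by the joint law is used for a nonempty
    index set; positivity of \<open>m\<close> and \<open>n\<close> provides it.\<close>
  have J: "J \<noteq> {}" "finite J" "J \<subseteq> corner_index m n"
    using mn by (auto simp: J_def corner_index_def)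
  have ind: "indep_vars (\<lambda>_. borel) (\<lambda>(i, j) \<omega>. H \<omega> i j) J"
    using H by (simp add: std_normal_matrix_def J_def)
  have dist: "distributed M lborel (\<lambda>\<omega>. H \<omega> i j) std_normal_density" if "(i, j) \<in> J" for i j
    using H that by (simp add: std_normal_matrix_def J_def)
  have rv: "random_variable borel (\<lambda>\<omega>. H \<omega> i j)" if "(i, j) \<in> J" for i j
    using distributed_measurable[OF dist[OF that]] by simp
  have comp: "distr M borel (\<lambda>\<omega>. H \<omega> i j) = std_gauss" if "(i, j) \<in> J" for i j
  proof -
    have "distr M borel (\<lambda>\<omega>. H \<omega> i j) = distr M lborel (\<lambda>\<omega>. H \<omega> i j)"
      by (rule distr_cong) auto
    then show ?thesis
      by (simp only: distributed_distr_eq_density[OF dist[OF that]] std_gauss_def)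
  qed
  let ?X = "\<lambda>k \<omega>. case k of (i, j) \<Rightarrow> H \<omega> i j"
  have rvX: "random_variable borel (?X k)" if "k \<in> J" for k
    using rv that by (cases k) auto
  have "distr M (PiM J (\<lambda>_. borel)) (\<lambda>\<omega>. \<lambda>k\<in>J. ?X k \<omega>) = PiM J (\<lambda>k. distr M borel (?X k))"
    using indep_vars_iff_distr_eq_PiM'[OF J(1), of ?X "\<lambda>_. borel"] rvX ind
    by (simp add: case_prod_beta')
  also have "\<dots> = gauss J"
    using comp by (intro PiM_cong) auto
  finally have M: "distr M (PiM J (\<lambda>_. borel)) (\<lambda>\<omega>. \<lambda>k\<in>J. ?X k \<omega>) = gauss J" .
  have G: "distr (gauss (corner_index m n)) (PiM J (\<lambda>_. borel)) (\<lambda>w. restrict w J) = gauss J"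
    using gauss.distr_PiM_restrict_finite[OF J(2,3)]
    by (simp add: sets_gauss cong: distr_cong)
  have meas: "corner_minmax m n \<in> borel_measurable (PiM J (\<lambda>_. borel))"
    unfolding minmax_value_def bilin_def
    by (intro borel_measurable_Min borel_measurable_Max borel_measurable_sum borel_measurable_times
        borel_measurable_const measurable_component_singleton) (auto simp: J_def)
  have mX: "(\<lambda>\<omega>. \<lambda>k\<in>J. ?X k \<omega>) \<in> M \<rightarrow>\<^sub>M PiM J (\<lambda>_. borel)"
    using rvX by (intro measurable_restrict) auto
  have mR: "(\<lambda>w. restrict w J) \<in> gauss (corner_index m n) \<rightarrow>\<^sub>M PiM J (\<lambda>_. borel)"
    using J by (intro measurable_restrict measurable_gauss_component) auto
  have eqX: "corner_minmax m n (\<lambda>k\<in>J. ?X k \<omega>) = minmax_value m n (H \<omega>)" for \<omega>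
    by (rule minmax_value_cong) (simp add: J_def)
  have eqR: "corner_minmax m n (restrict w J) = corner_minmax m n w" for w
    by (rule minmax_value_cong) (simp add: J_def)
  show "(\<lambda>\<omega>. minmax_value m n (H \<omega>)) \<in> borel_measurable M"
    using measurable_compose[OF mX meas] by (simp only: eqX)
  have "distr M borel (\<lambda>\<omega>. minmax_value m n (H \<omega>)) = distr (gauss J) borel (corner_minmax m n)"
    unfolding M[symmetric] by (subst distr_distr[OF meas mX]) (simp only: o_def eqX)
  also have "\<dots> = distr (gauss (corner_index m n)) borel (corner_minmax m n)"
    unfolding G[symmetric] by (subst distr_distr[OF meas mR]) (simp only: o_def eqR)
  finally show "distr M borel (\<lambda>\<omega>. minmax_value m n (H \<omega>))
      = distr (gauss (corner_index m n)) borel (corner_minmax m n)" .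
qed

lemma num_rows_ge: "\<alpha> > 0 \<Longrightarrow> \<alpha> * real n \<le> real (num_rows \<alpha> n)"
  unfolding num_rows_def by linarith

lemma num_rows_pos: "\<alpha> > 0 \<Longrightarrow> n > 0 \<Longrightarrow> num_rows \<alpha> n > 0"
  using num_rows_ge[of \<alpha> n] by (metis gr0I mult_pos_pos not_le of_nat_0 of_nat_0_less_iff)

text \<open>Rounding the number of rows up can only raise the mean of the decoupled
  variable.\<close>

lemma gordon_mean_ge:
  assumes "\<alpha> > 0"
  shows "sqrt (real n) * ((sqrt \<alpha> - 1) * sqrt (2 / pi))
    \<le> sqrt (2 / pi) * (sqrt (real (num_rows \<alpha> n)) - sqrt (real n))"
proof -
  have "sqrt \<alpha> * sqrt (real n) \<le> sqrt (real (num_rows \<alpha> n))"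
    using num_rows_ge[OF assms] by (simp flip: real_sqrt_mult)
  then have "sqrt (2 / pi) * (sqrt \<alpha> * sqrt (real n) - sqrt (real n))
      \<le> sqrt (2 / pi) * (sqrt (real (num_rows \<alpha> n)) - sqrt (real n))"
    by (intro mult_left_mono) auto
  then show ?thesis by (simp add: algebra_simps)
qed

lemma lim_ge_1I: "X \<longlonglongrightarrow> 1 \<Longrightarrow> lim_ge X 1"
  unfolding lim_ge_def by (auto simp: convergentI limI)

text \<open>Each \<open>n\<close> has its own probability space. The third limit is stated for
  eventually nonnegative \<open>\<xi>l\<close>, since a very negative threshold has a large square
  that \<open>\<xi> n\<close> squared may fail to reach. The bound on the mean holds for every
  positive \<open>n\<close>, not only in the limit.\<close>

theorem lemma11:
  fixes M :: "nat \<Rightarrow> 'a measure"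
    and H :: "nat \<Rightarrow> 'a \<Rightarrow> nat \<Rightarrow> nat \<Rightarrow> real"
    and \<alpha> \<epsilon>1m \<epsilon>1n \<epsilon>5g :: real
    and m :: "nat \<Rightarrow> nat"
    and \<xi> :: "nat \<Rightarrow> 'a \<Rightarrow> real"
    and \<xi>l :: "nat \<Rightarrow> real"
  assumes "\<alpha> > 0"
    and "\<And>n. m n = num_rows \<alpha> n"
    and "\<And>n. prob_space (M n)"
    and "\<And>n. std_normal_matrix (M n) (m n) n (H n)"
    and "\<And>n \<omega>. \<xi> n \<omega> = minmax_value (m n) n (H n \<omega>)"
    and "\<epsilon>1m > 0" and "\<epsilon>1n > 0" and "\<epsilon>5g > 0"
    and "\<forall>\<^sub>F n in sequentially.
           (1 - \<epsilon>1m) * sqrt \<alpha> * sqrt (2 / pi) - (1 + \<epsilon>1n) * sqrt (2 / pi) - \<epsilon>5g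
             > \<xi>l n / sqrt (real n)"
  shows
    "lim_ge (\<lambda>n. measure (M n) {\<omega> \<in> space (M n).
         (MIN x\<in>normalized_cube n. MAX y\<in>normalized_cube (m n). bilin (m n) n (H n \<omega>) y x)
           \<ge> \<xi>l n}) 1
     \<and> lim_ge (\<lambda>n. measure (M n) {\<omega> \<in> space (M n). \<xi> n \<omega> \<ge> \<xi>l n}) 1
     \<and> ((\<forall>\<^sub>F n in sequentially. \<xi>l n \<ge> 0) \<longrightarrow>
          lim_ge (\<lambda>n. measure (M n) {\<omega> \<in> space (M n). (\<xi> n \<omega>)\<^sup>2 \<ge> (\<xi>l n)\<^sup>2}) 1)
     \<and> (\<forall>n>0.
          (\<integral>\<omega>. \<xi> n \<omega> \<partial>M n) / sqrt (real n)
            = (\<integral>\<omega>. (MIN x\<in>normalized_cube n. MAX y\<in>normalized_cube (m n).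
                   bilin (m n) n (H n \<omega>) y x) \<partial>M n) / sqrt (real n)
          \<and> (\<integral>\<omega>. \<xi> n \<omega> \<partial>M n) / sqrt (real n) \<ge> (sqrt \<alpha> - 1) * sqrt (2 / pi))"
proof -
  note alpha = assms(1) and eps = assms(6-8)
  let ?G = "\<lambda>n. gauss (corner_index (m n) n)"
  let ?Z = "\<lambda>n. corner_minmax (m n) n"
  have xi: "(MIN x\<in>normalized_cube n. MAX y\<in>normalized_cube (m n). bilin (m n) n (H n \<omega>) y x) = \<xi> n \<omega>"
    for n \<omega>
    by (simp only: assms(5) minmax_value_def)
  have m: "m n = num_rows \<alpha> n" for n by (rule assms(2))
  have mpos: "m n > 0" if "n > 0" for n
    using num_rows_pos[OF alpha that] by (simp add: m)
  have xi_meas: "\<xi> n \<in> borel_measurable (M n)" and xi_distr: "distr (M n) borel (\<xi> n) = distr (?G n) borel (?Z n)"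
    if "n > 0" for n
  proof -
    have "\<xi> n = (\<lambda>\<omega>. minmax_value (m n) n (H n \<omega>))"
      using assms(5) by auto
    then show "\<xi> n \<in> borel_measurable (M n)" "distr (M n) borel (\<xi> n) = distr (?G n) borel (?Z n)"
      using std_normal_matrix_minmax_distr[OF assms(3) assms(4) mpos[OF that] that] by simp_all
  qed

  let ?p = "\<lambda>n. measure (M n) {\<omega> \<in> space (M n). \<xi> n \<omega> \<ge> \<xi>l n}"
  \<comment> \<open>The constant 12 is the 3 of \<open>corner_minmax_tail\<close> divided by the
    square of \<open>\<epsilon>5g / 2\<close>.\<close>
  have "\<forall>\<^sub>F n in sequentially. 1 - 12 / \<epsilon>5g\<^sup>2 * inverse (real n) \<le> ?p n"
    using assms(9) eventually_gt_at_top[of 0]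
  proof eventually_elim
    case (elim n)
    interpret prob_space "M n" by (rule assms(3))
    \<comment> \<open>The threshold lies at least \<open>\<epsilon>5g * sqrt n\<close> below the
      Gaussian mean; \<open>\<eta>\<close> is half of this gap.\<close>
    define \<eta> where "\<eta> = \<epsilon>5g / 2 * sqrt (real n)"
    have eta: "\<eta> > 0" using eps elim by (simp add: \<eta>_def)
    \<comment> \<open>As \<open>\<epsilon>1m\<close> and \<open>\<epsilon>1n\<close> are positive,
      the hypothesis places \<open>\<xi>l n / sqrt n\<close> below
      \<open>(sqrt \<alpha> - 1) * sqrt (2 / pi)\<close> by at least
      \<open>\<epsilon>5g\<close>.\<close>
    have "(1 - \<epsilon>1m) * sqrt \<alpha> * sqrt (2 / pi) - (1 + \<epsilon>1n) * sqrt (2 / pi)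
        \<le> 1 * sqrt \<alpha> * sqrt (2 / pi) - 1 * sqrt (2 / pi)"
      using eps alpha by (intro diff_mono mult_right_mono) auto
    then have "\<xi>l n / sqrt (real n) \<le> (sqrt \<alpha> - 1) * sqrt (2 / pi) - \<epsilon>5g"
      using elim by (simp add: algebra_simps)
    then have "\<xi>l n \<le> sqrt (real n) * ((sqrt \<alpha> - 1) * sqrt (2 / pi) - \<epsilon>5g)"
      using elim by (simp add: pos_divide_le_eq mult.commute)
    then have "\<xi>l n + 2 * \<eta> \<le> sqrt (real n) * ((sqrt \<alpha> - 1) * sqrt (2 / pi))"
      by (simp add: \<eta>_def algebra_simps)
    also have "\<dots> \<le> sqrt (2 / pi) * (sqrt (real (m n)) - sqrt (real n))"
      unfolding m by (rule gordon_mean_ge[OF alpha])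
    finally have c: "\<xi>l n + 2 * \<eta> \<le> sqrt (2 / pi) * (sqrt (real (m n)) - sqrt (real n))" .
    note [measurable] = xi_meas[OF elim(2)]
    have "prob {\<omega> \<in> space (M n). \<xi> n \<omega> < \<xi>l n} = measure (distr (M n) borel (\<xi> n)) {..<\<xi>l n}"
      by (subst measure_distr) (auto intro!: arg_cong[where f=prob])
    also have "\<dots> = measure (?G n) {w \<in> space (?G n). ?Z n w < \<xi>l n}"
      unfolding xi_distr[OF elim(2)]
      by (subst measure_distr) (auto intro!: arg_cong[where f="measure (?G n)"])
    also have "\<dots> \<le> 3 / \<eta>\<^sup>2"
      by (rule corner_minmax_tail[OF mpos[OF elim(2)] elim(2) eta c])
    also have "\<dots> = 12 / \<epsilon>5g\<^sup>2 * inverse (real n)"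
      by (simp add: \<eta>_def power_mult_distrib power_divide inverse_eq_divide)
    finally have "prob {\<omega> \<in> space (M n). \<xi> n \<omega> < \<xi>l n} \<le> 12 / \<epsilon>5g\<^sup>2 * inverse (real n)" .
    moreover have "{\<omega> \<in> space (M n). \<xi> n \<omega> \<ge> \<xi>l n} = space (M n) - {\<omega> \<in> space (M n). \<xi> n \<omega> < \<xi>l n}"
      by auto
    ultimately show ?case by (simp add: prob_compl)
  qed
  moreover have le1: "measure (M n) E \<le> 1" for n E
    by (rule prob_space.prob_le_1[OF assms(3)])
  moreover have "(\<lambda>n. 1 - 12 / \<epsilon>5g\<^sup>2 * inverse (real n)) \<longlonglongrightarrow> 1 - 12 / \<epsilon>5g\<^sup>2 * 0"
    by (intro tendsto_intros lim_inverse_n)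
  ultimately have lim: "?p \<longlonglongrightarrow> 1"
    by (intro tendsto_sandwich[of "\<lambda>n. 1 - 12 / \<epsilon>5g\<^sup>2 * inverse (real n)" ?p _ "\<lambda>_. 1"]) auto

  \<comment> \<open>For a nonnegative threshold the event \<open>\<xi> n \<ge> \<xi>l n\<close> is
    contained in the squared event, so the limit is inherited.\<close>
  have sq: "(\<lambda>n. measure (M n) {\<omega> \<in> space (M n). (\<xi> n \<omega>)\<^sup>2 \<ge> (\<xi>l n)\<^sup>2}) \<longlonglongrightarrow> 1"
    if nonneg: "\<forall>\<^sub>F n in sequentially. \<xi>l n \<ge> 0"
  proof (rule tendsto_sandwich[OF _ _ lim])
    show "\<forall>\<^sub>F n in sequentially. ?p n \<le> measure (M n) {\<omega> \<in> space (M n). (\<xi> n \<omega>)\<^sup>2 \<ge> (\<xi>l n)\<^sup>2}"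
      using nonneg eventually_gt_at_top[of 0]
    proof eventually_elim
      case (elim n)
      interpret prob_space "M n" by (rule assms(3))
      note [measurable] = xi_meas[OF elim(2)]
      show ?case using elim by (intro finite_measure_mono) (auto intro: power_mono)
    qed
  qed (auto simp: le1)

  have mean: "(sqrt \<alpha> - 1) * sqrt (2 / pi) \<le> (\<integral>\<omega>. \<xi> n \<omega> \<partial>M n) / sqrt (real n)" if n: "n > 0" for n
  proof -
    have "(\<integral>\<omega>. \<xi> n \<omega> \<partial>M n) = (\<integral>x. x \<partial>distr (M n) borel (\<xi> n))"
      by (subst integral_distr) (auto intro: xi_meas[OF n])
    also have "\<dots> = (\<integral>w. ?Z n w \<partial>?G n)"
      unfolding xi_distr[OF n] by (subst integral_distr) auto
    finally have eq: "(\<integral>\<omega>. \<xi> n \<omega> \<partial>M n) = (\<integral>w. ?Z n w \<partial>?G n)" .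
    have "sqrt (real n) * ((sqrt \<alpha> - 1) * sqrt (2 / pi)) \<le> (\<integral>\<omega>. \<xi> n \<omega> \<partial>M n)"
      unfolding eq using gordon_mean_ge[OF alpha, of n, folded m]
      by (rule order_trans) (rule corner_minmax_expectation_ge[OF mpos[OF n] n])
    then show ?thesis using n by (simp add: pos_le_divide_eq mult.commute)
  qed

  show ?thesis
    unfolding xi using lim sq mean by (auto intro: lim_ge_1I)
qed

end
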